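(* Given a DTD $D$ over a finite alphabet $\Sigma$ and a finite collection $\mathcal{C}$ of integrity constraints, one can construct a weak ODTA $\mathcal{S}$ in non-deterministic polynomial time such that (some run of the construction yields) $\mathcal{S}$ accepting at least one ordered-data tree if and only if there exists an ordered-data tree that conforms to $D$ and satisfies all constraints in $\mathcal{C}$.
   Context: An ordered-data tree over a finite alphabet $\Sigma$ is a finite unranked ordered tree in which each node carries a label in $\Sigma$ and a data value in $\mathbb{N}$; $\mathrm{Proj}(t)$ is $t$ without data values. A DTD over $\Sigma$ is a context-free grammar whose derivation trees are the conforming trees; a tree conforms to $D$ if its label projection is such a derivation tree. Integrity constraints: a key constraint $\mathrm{key}(a)$ is $\forall x\forall y\,(a(x)\wedge a(y)\wedge x\sim y\to x=y)$; an inclusion constraint $V(a)\subseteq V(b)$ is $\forall x\exists y\,(a(x)\to b(y)\wedge x\sim y)$, where $x\sim y$ means equal data values. A letter-to-letter tree transducer from $\Sigma$ to $\Gamma$ is an unranked tree automaton (states $Q$, final states $F$, transitions $\delta(q,a)$ regular languages over $Q$ constraining the state-word of the children) with an output relation $\mu\subseteq Q\times\Sigma\times\Gamma$; $t'$ is an output on $t$ if there is an accepting run $\rho$ on $t$ with $(\rho(u),\mathrm{lab}_t(u),\mathrm{lab}_{t'}(u))\in\mu$ at every node. For $t$ over $\Gamma$, $V_t(a)$ is the set of data values of $a$-nodes, $[S]_t=\bigcap_{a\in S}V_t(a)\cap\bigcap_{b\notin S}\overline{V_t(b)}$ for $S\subseteq\Gamma$, and if $d_1<\dots<d_m$ are all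 data values of $t$, $\mathcal{V}_\Gamma(t)=S_1\cdots S_m$ over $2^\Gamma\setminus\{\emptyset\}$ with $d_i\in[S_i]_t$. A weak ODTA over $\Sigma$ is $\langle\mathcal{T},\mathcal{M},\Gamma_0\rangle$ where $\mathcal{T}$ is a letter-to-letter tree transducer from $\Sigma$ to $\Gamma$, $\mathcal{M}$ a finite string automaton over $2^\Gamma$, and $\Gamma_0\subseteq\Gamma$; it accepts $t$ iff there is an ordered-data tree $t'$ over $\Gamma$ that is an output of $\mathcal{T}$ on $\mathrm{Proj}(t)$ (carrying the data values of $t$) such that $\mathcal{M}$ accepts $\mathcal{V}_\Gamma(t')$ and for every $a\in\Gamma_0$ the $a$-nodes of $t'$ have pairwise distinct data values. *)

theory Defs
  imports "HOL-Computational_Algebra.Polynomial"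
begin

section \<open>Ordered-data trees\<close>

text \<open>A finite alphabet of size \<open>n\<close> is the set \<open>{..<n}\<close>. An ordered-data tree is a tree whose
  nodes carry pairs (label, data value).\<close>

datatype 'a tree = Node (root: 'a) (children: "'a tree list")

type_synonym dtree = "(nat \<times> nat) tree"

definition Proj :: "dtree \<Rightarrow> nat tree" where
  "Proj = map_tree fst"

text \<open>Nodes are addressed by the sequence of child indices leading to them.\<close>

primrec subtree :: "'a tree \<Rightarrow> nat list \<Rightarrow> 'a tree" where
  "subtree t [] = t"
| "subtree t (i # u) = subtree (children t ! i) u"

inductive_set nodes :: "'a tree \<Rightarrow> nat list set" for t :: "'a tree" where
  "[] \<in> nodes t"
| "\<lbrakk>u \<in> nodes t; i < length (children (subtree t u))\<rbrakk> \<Longrightarrow> u @ [i] \<in> nodes t"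

definition val_at :: "'a tree \<Rightarrow> nat list \<Rightarrow> 'a" where
  "val_at t u = root (subtree t u)"

definition arity :: "'a tree \<Rightarrow> nat list \<Rightarrow> nat" where
  "arity t u = length (children (subtree t u))"

definition lab :: "dtree \<Rightarrow> nat list \<Rightarrow> nat" where
  "lab t u = fst (val_at t u)"

definition dat :: "dtree \<Rightarrow> nat list \<Rightarrow> nat" where
  "dat t u = snd (val_at t u)"

definition tree_over :: "nat \<Rightarrow> dtree \<Rightarrow> bool" where
  "tree_over n t \<longleftrightarrow> (\<forall>u\<in>nodes t. lab t u < n)"


section \<open>Regular languages\<close>

datatype 'a rexp =
    Zero | One | Atom 'a
  | Plus "'a rexp" "'a rexp" | Times "'a rexp" "'a rexp" | Star "'a rexp"

primrec lang :: "'a rexp \<Rightarrow> 'a list set" where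
  "lang Zero = {}"
| "lang One = {[]}"
| "lang (Atom a) = {[a]}"
| "lang (Plus r s) = lang r \<union> lang s"
| "lang (Times r s) = {v @ w |v w. v \<in> lang r \<and> w \<in> lang s}"
| "lang (Star r) = {concat ws |ws. set ws \<subseteq> lang r}"

text \<open>Finite automata over \<open>2\<^sup>\<Gamma>\<close>: the letters of the transitions are finite sets, written as lists
  of their elements.\<close>

record nfa =
  nfa_size :: nat
  nfa_init :: "nat list"
  nfa_final :: "nat list"
  nfa_trans :: "(nat \<times> nat list \<times> nat) list"

definition wf_nfa :: "nat \<Rightarrow> nfa \<Rightarrow> bool" where
  "wf_nfa g A \<longleftrightarrow>
     (\<forall>p\<in>set (nfa_init A). p < nfa_size A) \<and> (\<forall>p\<in>set (nfa_final A). p < nfa_size A) \<and>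
     (\<forall>(p, S, q)\<in>set (nfa_trans A). p < nfa_size A \<and> set S \<subseteq> {..<g} \<and> q < nfa_size A)"

definition nfa_accepts :: "nfa \<Rightarrow> nat set list \<Rightarrow> bool" where
  "nfa_accepts A w \<longleftrightarrow> (\<exists>r. length r = Suc (length w) \<and>
     r ! 0 \<in> set (nfa_init A) \<and> r ! length w \<in> set (nfa_final A) \<and>
     (\<forall>i<length w. \<exists>S. set S = w ! i \<and> (r ! i, S, r ! Suc i) \<in> set (nfa_trans A)))"


section \<open>DTDs and integrity constraints\<close>

text \<open>A DTD over \<open>{..<n}\<close> is an (extended) context-free grammar. The letters that are not
  terminals are the nonterminals. The right-hand sides of productions are regular expressions;
  an ordinary context-free grammar is the special case in which each of them is a product of
  atoms (or \<open>One\<close>, for an empty right-hand side).\<close>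

record dtd =
  dtd_start :: nat
  dtd_terminals :: "nat list"
  dtd_prods :: "(nat \<times> nat rexp) list"

definition wf_dtd :: "nat \<Rightarrow> dtd \<Rightarrow> bool" where
  "wf_dtd n D \<longleftrightarrow>
     set (dtd_terminals D) \<subseteq> {..<n} \<and>
     dtd_start D \<in> {..<n} - set (dtd_terminals D) \<and>
     (\<forall>(a, r)\<in>set (dtd_prods D). a \<in> {..<n} - set (dtd_terminals D) \<and> set_rexp r \<subseteq> {..<n})"

definition derivation_tree :: "nat \<Rightarrow> dtd \<Rightarrow> nat tree \<Rightarrow> bool" where
  "derivation_tree n D t \<longleftrightarrow> val_at t [] = dtd_start D \<and>
     (\<forall>u\<in>nodes t. val_at t u < n \<and>
        (if val_at t u \<in> set (dtd_terminals D) then arity t u = 0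
         else \<exists>r. (val_at t u, r) \<in> set (dtd_prods D) \<and>
                  map (\<lambda>i. val_at t (u @ [i])) [0..<arity t u] \<in> lang r))"

definition conforms :: "nat \<Rightarrow> dtd \<Rightarrow> dtree \<Rightarrow> bool" where
  "conforms n D t \<longleftrightarrow> derivation_tree n D (Proj t)"

datatype constr = Key nat | Incl nat nat

primrec wf_constr :: "nat \<Rightarrow> constr \<Rightarrow> bool" where
  "wf_constr n (Key a) \<longleftrightarrow> a < n"
| "wf_constr n (Incl a b) \<longleftrightarrow> a < n \<and> b < n"

primrec sat :: "dtree \<Rightarrow> constr \<Rightarrow> bool" where
  "sat t (Key a) \<longleftrightarrow> (\<forall>x\<in>nodes t. \<forall>y\<in>nodes t.
     lab t x = a \<and> lab t y = a \<and> dat t x = dat t y \<longrightarrow> x = y)"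
| "sat t (Incl a b) \<longleftrightarrow> (\<forall>x\<in>nodes t. \<exists>y\<in>nodes t.
     lab t x = a \<longrightarrow> lab t y = b \<and> dat t x = dat t y)"


section \<open>Weak ODTA\<close>

text \<open>A letter-to-letter transducer from \<open>{..<n}\<close> to \<open>{..<g}\<close> with states \<open>{..<tr_states T}\<close>. The
  regular language \<open>\<delta>(q, a)\<close> is the union of the languages of all expressions listed for
  \<open>(q, a)\<close>.\<close>

record transducer =
  tr_states :: nat
  tr_final :: "nat list"
  tr_trans :: "(nat \<times> nat \<times> nat rexp) list"
  tr_out :: "(nat \<times> nat \<times> nat) list"

definition wf_transducer :: "nat \<Rightarrow> nat \<Rightarrow> transducer \<Rightarrow> bool" where
  "wf_transducer n g T \<longleftrightarrow>
     (\<forall>q\<in>set (tr_final T). q < tr_states T) \<and>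
     (\<forall>(q, a, r)\<in>set (tr_trans T). q < tr_states T \<and> a < n \<and> set_rexp r \<subseteq> {..<tr_states T}) \<and>
     (\<forall>(q, a, b)\<in>set (tr_out T). q < tr_states T \<and> a < n \<and> b < g)"

definition tr_delta :: "transducer \<Rightarrow> nat \<Rightarrow> nat \<Rightarrow> nat list set" where
  "tr_delta T q a = (\<Union>r\<in>{r. (q, a, r) \<in> set (tr_trans T)}. lang r)"

definition accepting_run :: "transducer \<Rightarrow> nat tree \<Rightarrow> (nat list \<Rightarrow> nat) \<Rightarrow> bool" where
  "accepting_run T t \<rho> \<longleftrightarrow> \<rho> [] \<in> set (tr_final T) \<and>
     (\<forall>u\<in>nodes t. \<rho> u < tr_states T \<and>
        map (\<lambda>i. \<rho> (u @ [i])) [0..<arity t u] \<in> tr_delta T (\<rho> u) (val_at t u))"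

definition output_on :: "transducer \<Rightarrow> nat tree \<Rightarrow> nat tree \<Rightarrow> bool" where
  "output_on T t t' \<longleftrightarrow> nodes t' = nodes t \<and>
     (\<exists>\<rho>. accepting_run T t \<rho> \<and> (\<forall>u\<in>nodes t. (\<rho> u, val_at t u, val_at t' u) \<in> set (tr_out T)))"

definition V :: "dtree \<Rightarrow> nat \<Rightarrow> nat set" where
  "V t a = {dat t u |u. u \<in> nodes t \<and> lab t u = a}"

definition cls :: "nat \<Rightarrow> dtree \<Rightarrow> nat set \<Rightarrow> nat set" where
  "cls g t S = (\<Inter>a\<in>S. V t a) \<inter> (\<Inter>b\<in>{..<g} - S. - V t b)"

text \<open>The word \<open>\<V>\<^sub>\<Gamma>(t)\<close> for \<open>\<Gamma> = {..<g}\<close>. For a tree over \<open>\<Gamma>\<close> the set described by \<open>THE\<close> exists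
  and is unique and nonempty.\<close>

definition vword :: "nat \<Rightarrow> dtree \<Rightarrow> nat set list" where
  "vword g t = map (\<lambda>d. THE S. S \<subseteq> {..<g} \<and> d \<in> cls g t S)
     (sorted_list_of_set (dat t ` nodes t))"

record odta =
  od_in :: nat
  od_out :: nat
  od_trans :: transducer
  od_aut :: nfa
  od_keys :: "nat list"

definition wf_odta :: "odta \<Rightarrow> bool" where
  "wf_odta S \<longleftrightarrow> wf_transducer (od_in S) (od_out S) (od_trans S) \<and>
     wf_nfa (od_out S) (od_aut S) \<and> set (od_keys S) \<subseteq> {..<od_out S}"

definition odta_accepts :: "odta \<Rightarrow> dtree \<Rightarrow> bool" where
  "odta_accepts S t \<longleftrightarrow> tree_over (od_in S) t \<and>
     (\<exists>t'. tree_over (od_out S) t' \<and> output_on (od_trans S) (Proj t) (Proj t') \<and>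
        (\<forall>u\<in>nodes t. dat t' u = dat t u) \<and>
        nfa_accepts (od_aut S) (vword (od_out S) t') \<and>
        (\<forall>a\<in>set (od_keys S). \<forall>x\<in>nodes t'. \<forall>y\<in>nodes t'.
           lab t' x = a \<and> lab t' y = a \<and> x \<noteq> y \<longrightarrow> dat t' x \<noteq> dat t' y))"


section \<open>Binary encodings\<close>

text \<open>Self-delimiting encodings; numbers are written in unary. An alphabet of size \<open>n\<close> is thereby
  charged \<open>n + 1\<close> bits, as if it were listed, so unary letters change the length of inputs at
  most polynomially. Injectivity is shown below.\<close>

definition enc_nat :: "nat \<Rightarrow> bool list" where
  "enc_nat n = replicate n True @ [False]"

definition enc_pair :: "('a \<Rightarrow> bool list) \<Rightarrow> ('b \<Rightarrow> bool list) \<Rightarrow> 'a \<times> 'b \<Rightarrow> bool list" where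
  "enc_pair e f x = e (fst x) @ f (snd x)"

primrec enc_list :: "('a \<Rightarrow> bool list) \<Rightarrow> 'a list \<Rightarrow> bool list" where
  "enc_list e [] = [False]"
| "enc_list e (x # xs) = True # e x @ enc_list e xs"

primrec enc_rexp :: "nat rexp \<Rightarrow> bool list" where
  "enc_rexp Zero = enc_nat 0"
| "enc_rexp One = enc_nat 1"
| "enc_rexp (Atom a) = enc_nat 2 @ enc_nat a"
| "enc_rexp (Plus r s) = enc_nat 3 @ enc_rexp r @ enc_rexp s"
| "enc_rexp (Times r s) = enc_nat 4 @ enc_rexp r @ enc_rexp s"
| "enc_rexp (Star r) = enc_nat 5 @ enc_rexp r"

primrec enc_constr :: "constr \<Rightarrow> bool list" where
  "enc_constr (Key a) = False # enc_nat a"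
| "enc_constr (Incl a b) = True # enc_nat a @ enc_nat b"

definition enc_dtd :: "dtd \<Rightarrow> bool list" where
  "enc_dtd D = enc_nat (dtd_start D) @ enc_list enc_nat (dtd_terminals D) @
     enc_list (enc_pair enc_nat enc_rexp) (dtd_prods D)"

definition enc_instance :: "nat \<Rightarrow> dtd \<Rightarrow> constr list \<Rightarrow> bool list" where
  "enc_instance n D C = enc_nat n @ enc_dtd D @ enc_list enc_constr C"

definition enc_nfa :: "nfa \<Rightarrow> bool list" where
  "enc_nfa A = enc_nat (nfa_size A) @ enc_list enc_nat (nfa_init A) @
     enc_list enc_nat (nfa_final A) @
     enc_list (enc_pair enc_nat (enc_pair (enc_list enc_nat) enc_nat)) (nfa_trans A)"

definition enc_transducer :: "transducer \<Rightarrow> bool list" where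
  "enc_transducer T = enc_nat (tr_states T) @ enc_list enc_nat (tr_final T) @
     enc_list (enc_pair enc_nat (enc_pair enc_nat enc_rexp)) (tr_trans T) @
     enc_list (enc_pair enc_nat (enc_pair enc_nat enc_nat)) (tr_out T)"

definition enc_odta :: "odta \<Rightarrow> bool list" where
  "enc_odta S = enc_nat (od_in S) @ enc_nat (od_out S) @ enc_transducer (od_trans S) @
     enc_nfa (od_aut S) @ enc_list enc_nat (od_keys S)"

definition self_delim :: "('a \<Rightarrow> bool list) \<Rightarrow> bool" where
  "self_delim e \<longleftrightarrow> (\<forall>x y u v. e x @ u = e y @ v \<longrightarrow> x = y \<and> u = v)"

lemma self_delimD: "self_delim e \<Longrightarrow> e x @ u = e y @ v \<longleftrightarrow> x = y \<and> u = v"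
  unfolding self_delim_def by blast

lemma self_delim_nat [simp]: "self_delim enc_nat"
  unfolding self_delim_def
proof (intro allI)
  fix x y u v
  show "enc_nat x @ u = enc_nat y @ v \<longrightarrow> x = y \<and> u = v"
  proof (induction x arbitrary: y)
    case 0
    show ?case by (cases y) (auto simp: enc_nat_def)
  next
    case (Suc x)
    then show ?case by (cases y) (auto simp: enc_nat_def)
  qed
qed

lemma self_delim_pair [simp]: "self_delim e \<Longrightarrow> self_delim f \<Longrightarrow> self_delim (enc_pair e f)"
  unfolding self_delim_def[of "enc_pair e f"]
  by (auto simp: enc_pair_def self_delimD prod_eq_iff)

lemma self_delim_list [simp]:
  assumes "self_delim e"
  shows "self_delim (enc_list e)"
  unfolding self_delim_def
proof (intro allI)
  fix x y u v
  show "enc_list e x @ u = enc_list e y @ v \<longrightarrow> x = y \<and> u = v"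
  proof (induction x arbitrary: y)
    case Nil
    show ?case by (cases y) auto
  next
    case (Cons a x)
    then show ?case by (cases y) (auto simp: self_delimD[OF assms])
  qed
qed

lemma self_delim_rexp [simp]: "self_delim enc_rexp"
proof -
  have "enc_rexp x @ u = enc_rexp y @ v \<longleftrightarrow> x = y \<and> u = v" for x y u v
  proof (induction x arbitrary: y u v)
    case Zero
    show ?case by (cases y) (simp_all add: self_delimD)
  next
    case One
    show ?case by (cases y) (simp_all add: self_delimD)
  next
    case (Atom a)
    show ?case by (cases y) (simp_all add: self_delimD)
  next
    case (Plus r s)
    then show ?case by (cases y) (simp_all add: self_delimD)
  next
    case (Times r s)
    then show ?case by (cases y) (simp_all add: self_delimD)
  next
    case (Star r)
    then show ?case by (cases y) (simp_all add: self_delimD)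
  qed
  then show ?thesis by (simp add: self_delim_def)
qed

lemma self_delim_constr [simp]: "self_delim enc_constr"
  unfolding self_delim_def
proof (intro allI)
  fix x y u v
  show "enc_constr x @ u = enc_constr y @ v \<longrightarrow> x = y \<and> u = v"
    by (cases x; cases y) (auto simp: self_delimD[OF self_delim_nat])
qed

lemma enc_instance_inject:
  "enc_instance n D C = enc_instance n' D' C' \<longleftrightarrow> n = n' \<and> D = D' \<and> C = C'"
  using self_delimD[OF self_delim_list[OF self_delim_constr], of C "[]" C' "[]"]
  by (auto simp: enc_instance_def enc_dtd_def self_delimD)

lemma enc_odta_inject: "enc_odta S = enc_odta S' \<longleftrightarrow> S = S'"
  using self_delimD[OF self_delim_list[OF self_delim_nat], of "od_keys S" "[]" "od_keys S'" "[]"]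
  by (auto simp: enc_odta_def enc_transducer_def enc_nfa_def self_delimD)


section \<open>Non-deterministic Turing machines\<close>

text \<open>Machines with \<open>tm_tapes\<close> two-way infinite tapes. A transition \<open>(q, as, q', acts)\<close> is enabled
  in state \<open>q\<close> when the scanned symbols are \<open>as\<close>; \<open>acts\<close> gives for each tape the symbol to be
  written and the head move. As there are finitely many transitions, only finitely many states
  and tape symbols are ever used. The blank is \<open>0\<close>, and the initial state is \<open>0\<close>.\<close>

datatype move = Left | Stay | Right

record ntm =
  tm_tapes :: nat
  tm_delta :: "(nat \<times> nat list \<times> nat \<times> (nat \<times> move) list) set"

definition wf_ntm :: "ntm \<Rightarrow> bool" where
  "wf_ntm M \<longleftrightarrow> tm_tapes M \<ge> 1 \<and> finite (tm_delta M) \<and>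
     (\<forall>(q, as, q', acts)\<in>tm_delta M. length as = tm_tapes M \<and> length acts = tm_tapes M)"

text \<open>A tape is given by its contents and its head position.\<close>

type_synonym tape = "(int \<Rightarrow> nat) \<times> int"
type_synonym config = "nat \<times> tape list"

definition read_tape :: "tape \<Rightarrow> nat" where
  "read_tape tp = fst tp (snd tp)"

primrec offset :: "move \<Rightarrow> int" where
  "offset Left = -1"
| "offset Stay = 0"
| "offset Right = 1"

definition act_tape :: "nat \<times> move \<Rightarrow> tape \<Rightarrow> tape" where
  "act_tape act tp = ((fst tp)(snd tp := fst act), snd tp + offset (snd act))"

definition step :: "ntm \<Rightarrow> (config \<times> config) set" where
  "step M = {((q, tps), (q', map2 act_tape acts tps)) |q tps q' acts.
     (q, map read_tape tps, q', acts) \<in> tm_delta M}"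

definition word_on_tape :: "bool list \<Rightarrow> int \<Rightarrow> nat" where
  "word_on_tape x i =
     (if 0 \<le> i \<and> i < int (length x) then (if x ! nat i then 2 else 1) else 0)"

text \<open>The input is on the first tape, the output on the last one.\<close>

definition init_config :: "ntm \<Rightarrow> bool list \<Rightarrow> config" where
  "init_config M x = (0, (word_on_tape x, 0) # replicate (tm_tapes M - 1) ((\<lambda>_. 0), 0))"

definition halts_with :: "ntm \<Rightarrow> bool list \<Rightarrow> config \<Rightarrow> bool" where
  "halts_with M x c \<longleftrightarrow> (init_config M x, c) \<in> (step M)\<^sup>* \<and> c \<notin> Domain (step M)"

definition config_output :: "config \<Rightarrow> bool list \<Rightarrow> bool" where
  "config_output c y \<longleftrightarrow> fst (last (snd c)) = word_on_tape y"

text \<open>Every computation path on input \<open>x\<close> has at most \<open>b\<close> steps.\<close>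

definition time_bounded :: "ntm \<Rightarrow> bool list \<Rightarrow> nat \<Rightarrow> bool" where
  "time_bounded M x b \<longleftrightarrow> (\<forall>k c. (init_config M x, c) \<in> step M ^^ k \<longrightarrow> k \<le> b)"

end

theory Submission
  imports Defs
begin

text \<open>The transducer simulates the DTD with the labels as states and copies the labels. Replacing the
  data value \<open>d\<close> of an \<open>a\<close>-node by the rank of \<open>d\<close> in \<open>V(a)\<close> turns each \<open>V(a)\<close> into an initial segment of
  the naturals and keeps its size. This preserves keys, and \<open>V(a) \<subseteq> V(b)\<close> remains true because it
  becomes \<open>|V(a)| \<le> |V(b)|\<close>. The sets \<open>V(a)\<close> then form a chain, so at most \<open>n\<close> letters of \<open>2\<^sup>\<Gamma>\<close> occur in
  \<open>\<V>\<^sub>\<Gamma>(t)\<close>. It therefore suffices to guess \<open>n\<close> letters; those that respect the inclusion constraints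
  become loops at the only accepting state of the string automaton.

  The Turing machine is obtained from a program in a small structured language whose continuations
  are the states. The guesses are read from an infinite bit sequence, which makes the execution
  deterministic, so that a single calculation covers all computation paths.\<close>

section \<open>Turing machines from structured programs\<close>

text \<open>Letters are guessed because \<open>2^Gamma\<close> has too many to be listed. Every
  guess is sound: a letter is looped on only if, for each constraint
  \<open>V(a) \<subseteq> V(b)\<close>, it contains \<open>b\<close> whenever it contains
  \<open>a\<close>, so a poor guess merely loses trees. Completeness asks for one good guess per
  satisfiable instance. Data values may be replaced label by label because the constraints see
  nothing of them but injectivity on the nodes of one label and inclusions between the sets
  \<open>V(a)\<close>. The letter guessed for label \<open>j\<close> is then
  \<open>{i. |V(j)| \<le> |V(i)|}\<close>. On the machine side the difficulty is that no path may
  abort: each one has to halt within the polynomial bound and leave the code of a well-formed weak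
  ODTA on the last tape.\<close>

definition symbol :: "bool \<Rightarrow> nat" where
  "symbol b = (if b then 2 else 1)"

datatype instr =
    Put nat bool
  | Mv nat move
  | Cond nat nat "instr list" "instr list"
  | Until nat nat "instr list"
  | Choose "instr list" "instr list"

type_synonym guesses = "nat \<Rightarrow> bool"

abbreviation stay :: "nat list \<Rightarrow> (nat \<times> move) list" where
  "stay \<equiv> map (\<lambda>a. (a, Stay))"

text \<open>The program that remains to be executed serves as the control state. The last argument
  resolves the nondeterminism of \<open>Choose\<close>.\<close>

fun eff :: "instr list \<Rightarrow> nat list \<Rightarrow> bool \<Rightarrow> (instr list \<times> (nat \<times> move) list) option" where
  "eff [] as b = None"
| "eff (Put k v # K) as b = Some (K, (stay as)[k := (symbol v, Right)])"
| "eff (Mv k d # K) as b = Some (K, (stay as)[k := (as ! k, d)])"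
| "eff (Cond k s p q # K) as b = Some ((if as ! k = s then p else q) @ K, stay as)"
| "eff (Until k s p # K) as b = Some (if as ! k = s then K else p @ Until k s p # K, stay as)"
| "eff (Choose p q # K) as b = Some ((if b then p else q) @ K, stay as)"

fun pop :: "instr list \<Rightarrow> guesses \<Rightarrow> guesses" where
  "pop (Choose p q # K) w = (\<lambda>i. w (Suc i))"
| "pop K w = w"

fun dstep :: "instr list \<times> tape list \<times> guesses \<Rightarrow> (instr list \<times> tape list \<times> guesses) option" where
  "dstep (K, T, w) = map_option (\<lambda>(K', acts). (K', map2 act_tape acts T, pop K w))
     (eff K (map read_tape T) (w 0))"

declare dstep.simps [simp del]

lemma dstep_Nil [simp]: "dstep ([], T, w) = None"
  by (simp add: dstep.simps)

primrec steps :: "nat \<Rightarrow> instr list \<times> tape list \<times> guesses \<Rightarrow> (instr list \<times> tape list \<times> guesses) option" where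
  "steps 0 c = Some c"
| "steps (Suc k) c = Option.bind (dstep c) (steps k)"

lemma steps_add: "steps (j + k) c = Option.bind (steps j c) (steps k)"
  by (induction j arbitrary: c) (auto split: bind_split)

text \<open>Control states must be finitely many although loops are unfolded. The body of a loop is
  executed in front of the loop itself, so each iteration ends in a continuation already
  counted.\<close>

fun conts :: "instr list \<Rightarrow> instr list \<Rightarrow> instr list set" where
  "conts [] K = {K}"
| "conts (Put k v # p) K = insert ((Put k v # p) @ K) (conts p K)"
| "conts (Mv k d # p) K = insert ((Mv k d # p) @ K) (conts p K)"
| "conts (Cond k s a b # p) K =
     insert ((Cond k s a b # p) @ K) (conts a (p @ K) \<union> conts b (p @ K) \<union> conts p K)"
| "conts (Until k s a # p) K =
     insert ((Until k s a # p) @ K) (conts a ((Until k s a # p) @ K) \<union> conts p K)"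
| "conts (Choose a b # p) K =
     insert ((Choose a b # p) @ K) (conts a (p @ K) \<union> conts b (p @ K) \<union> conts p K)"

lemma finite_conts: "finite (conts p K)"
  by (induction p K rule: conts.induct) auto

lemma conts_start: "p @ K \<in> conts p K"
  by (induction p K rule: conts.induct) auto

text \<open>\<open>K\<close> is excluded because its next step belongs to the surrounding program.
  Where a branch or loop body ends, the continuation reached is again in the outer set.\<close>

lemma conts_closed:
  "L \<in> conts p K \<Longrightarrow> eff L as b = Some (L', acts) \<Longrightarrow> L \<noteq> K \<Longrightarrow> L' \<in> conts p K"
proof (induction p K rule: conts.induct)
  case (2 k v p K)
  then consider "L = Put k v # p @ K" | "L \<in> conts p K"
    by auto
  then show ?case
    by cases (use 2 conts_start[of p K] in simp_all)
next
  case (3 k d p K)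
  then consider "L = Mv k d # p @ K" | "L \<in> conts p K"
    by auto
  then show ?case
    by cases (use 3 conts_start[of p K] in simp_all)
next
  case (4 k s a c p K)
  then consider "L = Cond k s a c # p @ K" | "L \<in> conts p K"
    | "L \<in> conts a (p @ K)" "L \<noteq> p @ K" | "L \<in> conts c (p @ K)" "L \<noteq> p @ K"
    using conts_start[of p K] by auto
  then show ?case
  proof cases
    case 1
    then have "L' = a @ p @ K \<or> L' = c @ p @ K"
      using 4(5) by (auto split: if_splits)
    then show ?thesis
      using conts_start[of a "p @ K"] conts_start[of c "p @ K"] by auto
  qed (use 4 in simp_all)
next
  case (5 k s a p K)
  then consider "L = Until k s a # p @ K" | "L \<in> conts p K"
    | "L \<in> conts a (Until k s a # p @ K)" "L \<noteq> Until k s a # p @ K"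
    by auto
  then show ?case
  proof cases
    case 1
    then have "L' = p @ K \<or> L' = a @ Until k s a # p @ K"
      using 5(4) by (auto split: if_splits)
    then show ?thesis
      using conts_start[of p K] conts_start[of a "Until k s a # p @ K"] by auto
  qed (use 5 in simp_all)
next
  case (6 a c p K)
  then consider "L = Choose a c # p @ K" | "L \<in> conts p K"
    | "L \<in> conts a (p @ K)" "L \<noteq> p @ K" | "L \<in> conts c (p @ K)" "L \<noteq> p @ K"
    using conts_start[of p K] by auto
  then show ?case
  proof cases
    case 1
    then have "L' = a @ p @ K \<or> L' = c @ p @ K"
      using 6(5) by (auto split: if_splits)
    then show ?thesis
      using conts_start[of a "p @ K"] conts_start[of c "p @ K"] by auto
  qed (use 6 in simp_all)
qed simp

definition machine :: "nat \<Rightarrow> (instr list \<Rightarrow> nat) \<Rightarrow> instr list \<Rightarrow> ntm" where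
  "machine m code p = \<lparr>tm_tapes = m, tm_delta = {(code K, as, code K', acts) |K as K' acts b.
     K \<in> conts p [] \<and> length as = m \<and> set as \<subseteq> {0, 1, 2} \<and> eff K as b = Some (K', acts)}\<rparr>"

lemma length_eff: "eff K as b = Some (K', acts) \<Longrightarrow> length acts = length as"
  by (cases "(K, as, b)" rule: eff.cases) auto

lemma wf_machine:
  assumes "m \<ge> 1"
  shows "wf_ntm (machine m code p)"
proof -
  define A where "A = conts p [] \<times> {as. set as \<subseteq> {0, 1, 2::nat} \<and> length as = m} \<times> (UNIV :: bool set)"
  \<comment> \<open>A finite superset of the transitions suffices, so the tuple returned for a
    halted program is arbitrary.\<close>
  define f where "f = (\<lambda>(K, as, b). case eff K as b of
      None \<Rightarrow> (0, [], 0, []) | Some (K', acts) \<Rightarrow> (code K, as, code K', acts))"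
  have "finite A"
    unfolding A_def by (intro finite_cartesian_product finite_conts finite_lists_length_eq) simp_all
  moreover have "tm_delta (machine m code p) \<subseteq> f ` A"
  proof
    fix e
    assume "e \<in> tm_delta (machine m code p)"
    then obtain K as K' acts b where e: "e = (code K, as, code K', acts)" "K \<in> conts p []"
        "length as = m" "set as \<subseteq> {0, 1, 2}" "eff K as b = Some (K', acts)"
      unfolding machine_def ntm.simps by blast
    then have "f (K, as, b) = e" "(K, as, b) \<in> A"
      by (simp_all add: f_def A_def)
    then show "e \<in> f ` A"
      by (metis imageI)
  qed
  ultimately have "finite (tm_delta (machine m code p))"
    by (meson finite_imageI finite_subset)
  then show ?thesis
    using assms by (auto simp: wf_ntm_def machine_def dest: length_eff)
qed

definition symbols_ok :: "tape list \<Rightarrow> bool" where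
  "symbols_ok T \<longleftrightarrow> (\<forall>tp\<in>set T. \<forall>i. fst tp i \<in> {0, 1, 2})"

lemma symbols_ok_read:
  assumes "symbols_ok T"
  shows "set (map read_tape T) \<subseteq> {0, 1, 2}"
proof
  fix s
  assume "s \<in> set (map read_tape T)"
  then obtain tp where "tp \<in> set T" "s = read_tape tp"
    by auto
  then show "s \<in> {0, 1, 2}"
    using assms by (simp add: symbols_ok_def read_tape_def)
qed

text \<open>A step writes back a scanned symbol or the code of a bit. No fourth symbol ever arises,
  so the restriction in \<open>machine\<close> loses no step.\<close>

lemma eff_symbols:
  assumes "eff K as b = Some (K', acts)" "set as \<subseteq> {0, 1, 2}"
  shows "fst ` set acts \<subseteq> {0, 1, 2}"
proof -
  have stay: "fst ` set (stay as) = set as"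
    by (simp add: image_image)
  have put: "fst ` set ((stay as)[k := (v, d)]) \<subseteq> {0, 1, 2}" if "v \<in> {0, 1, 2}" for k v d
  proof -
    have "fst ` set ((stay as)[k := (v, d)]) \<subseteq> fst ` insert (v, d) (set (stay as))"
      by (intro image_mono set_update_subset_insert)
    also have "\<dots> = insert v (set as)"
      by (simp only: image_insert stay fst_conv)
    finally show ?thesis
      using that assms(2) by (meson insert_subset order_trans)
  qed
  have mv: "fst ` set ((stay as)[k := (as ! k, d)]) \<subseteq> {0, 1, 2}" for k d
  proof (cases "k < length as")
    case True
    then show ?thesis
      using assms(2) nth_mem by (intro put) blast
  next
    case False
    then show ?thesis
      using assms(2) stay by (simp add: list_update_beyond not_less)
  qed
  consider "acts = stay as" | k v where "acts = (stay as)[k := (symbol v, Right)]"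
    | k d where "acts = (stay as)[k := (as ! k, d)]"
    using assms(1) by (cases "(K, as, b)" rule: eff.cases) auto
  then show ?thesis
  proof cases
    case 1
    then show ?thesis
      using stay assms(2) by (simp only:)
  next
    case 2
    then show ?thesis
      using put by (simp add: symbol_def)
  next
    case 3
    then show ?thesis
      using mv by (simp only:)
  qed
qed

lemma symbols_ok_act:
  assumes "symbols_ok T" "fst ` set acts \<subseteq> {0, 1, 2}"
  shows "symbols_ok (map2 act_tape acts T)"
  unfolding symbols_ok_def
proof (intro ballI allI)
  fix tp' i
  assume "tp' \<in> set (map2 act_tape acts T)"
  then obtain a tp where a: "(a, tp) \<in> set (zip acts T)" "tp' = act_tape a tp"
    by auto
  have "a \<in> set acts" "tp \<in> set T"
    using a(1) by (blast dest: set_zip_leftD set_zip_rightD)+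
  then have "fst a \<in> {0, 1, 2}" "fst tp i \<in> {0, 1, 2}"
    using assms by (auto simp: symbols_ok_def)
  then show "fst tp' i \<in> {0, 1, 2}"
    by (simp add: a(2) act_tape_def)
qed

lemma eff_total: "K \<noteq> [] \<Longrightarrow> \<exists>K' acts. eff K as b = Some (K', acts)"
  by (cases "(K, as, b)" rule: eff.cases) auto

section \<open>Computation paths of the machine and sequences of guesses\<close>

context
  fixes m :: nat and code :: "instr list \<Rightarrow> nat" and p :: "instr list"
  assumes inj: "inj_on code (conts p [])"
begin

lemma machine_step:
  assumes "K \<in> conts p []" "length T = m" "symbols_ok T" "dstep (K, T, w) = Some (K', T', w')"
  shows "((code K, T), (code K', T')) \<in> step (machine m code p)"
  using assms symbols_ok_read[OF assms(3)]
  by (fastforce simp: step_def machine_def dstep.simps)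

lemma dstep_invariant:
  assumes "K \<in> conts p []" "length T = m" "symbols_ok T" "dstep (K, T, w) = Some (K', T', w')"
  shows "K' \<in> conts p [] \<and> length T' = m \<and> symbols_ok T'"
proof -
  obtain acts where e: "eff K (map read_tape T) (w 0) = Some (K', acts)" "T' = map2 act_tape acts T"
    using assms(4) by (auto simp: dstep.simps)
  then have "K \<noteq> []"
    by auto
  then show ?thesis
    using e conts_closed[OF assms(1) e(1)] length_eff[OF e(1)] assms(2)
      symbols_ok_act[OF assms(3) eff_symbols[OF e(1) symbols_ok_read[OF assms(3)]]] by simp
qed

text \<open>The remaining guesses \<open>w'\<close> come before \<open>w\<close> in the
  quantification: a step fixes at most one bit, which is put in front of the guesses that later
  steps ask for.\<close>

lemma machine_step_lift:
  assumes "K \<in> conts p []" "((code K, T), c) \<in> step (machine m code p)"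
  shows "\<exists>K' T'. c = (code K', T') \<and> (\<forall>w'. \<exists>w. dstep (K, T, w) = Some (K', T', w'))"
proof -
  obtain L K' acts b where e: "L \<in> conts p []" "code L = code K" "c = (code K', map2 act_tape acts T)"
      "eff L (map read_tape T) b = Some (K', acts)"
    using assms(2) by (auto simp: step_def machine_def)
  have [simp]: "L = K"
    using inj e(1,2) assms(1) by (auto dest: inj_onD)
  have "\<exists>w. dstep (K, T, w) = Some (K', map2 act_tape acts T, w')" for w'
  proof (cases "\<exists>q r K0. K = Choose q r # K0")
    case True
    then have "dstep (K, T, case_nat b w') = Some (K', map2 act_tape acts T, w')"
      using e by (auto simp: dstep.simps)
    then show ?thesis
      by blast
  next
    case False
    then have "eff K (map read_tape T) (w' 0) = Some (K', acts)" "pop K w' = w'"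
      using e(4) by (cases "(K, map read_tape T, b)" rule: eff.cases; simp)+
    then have "dstep (K, T, w') = Some (K', map2 act_tape acts T, w')"
      by (simp add: dstep.simps)
    then show ?thesis
      by blast
  qed
  then show ?thesis
    using e(3) by blast
qed

text \<open>The guesses are collected from the end of the path backwards, each step extending the
  sequence found for the rest.\<close>

lemma machine_path_lift:
  assumes "K \<in> conts p []" "length T = m" "symbols_ok T"
    "((code K, T), c) \<in> step (machine m code p) ^^ k"
  shows "\<exists>w K' T' w'. c = (code K', T') \<and> steps k (K, T, w) = Some (K', T', w') \<and>
    K' \<in> conts p [] \<and> length T' = m \<and> symbols_ok T'"
  using assms
proof (induction k arbitrary: K T)
  case (Suc k)
  obtain d where d: "((code K, T), d) \<in> step (machine m code p)" "(d, c) \<in> step (machine m code p) ^^ k"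
    using Suc.prems(4) by (meson relpow_Suc_D2)
  obtain K1 T1 where K1: "d = (code K1, T1)" "\<And>w'. \<exists>w. dstep (K, T, w) = Some (K1, T1, w')"
    using machine_step_lift[OF Suc.prems(1) d(1)] by blast
  have inv: "K1 \<in> conts p [] \<and> length T1 = m \<and> symbols_ok T1"
    using dstep_invariant[OF Suc.prems(1-3)] K1(2) by blast
  then obtain w K' T' w' where r: "c = (code K', T')" "steps k (K1, T1, w) = Some (K', T', w')"
      "K' \<in> conts p [] \<and> length T' = m \<and> symbols_ok T'"
    using Suc.IH[of K1 T1] d(2) K1(1) by blast
  obtain w0 where "dstep (K, T, w0) = Some (K1, T1, w)"
    using K1(2) by blast
  then have "steps (Suc k) (K, T, w0) = Some (K', T', w')"
    using r(2) by simp
  then show ?case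
    using r by blast
qed auto

lemma steps_machine:
  assumes "K \<in> conts p []" "length T = m" "symbols_ok T" "steps k (K, T, w) = Some (K', T', w')"
  shows "((code K, T), (code K', T')) \<in> (step (machine m code p))\<^sup>*"
  using assms
proof (induction k arbitrary: K T w)
  case (Suc k)
  obtain K1 T1 w1 where d: "dstep (K, T, w) = Some (K1, T1, w1)" "steps k (K1, T1, w1) = Some (K', T', w')"
    using Suc.prems(4) by (auto simp: bind_eq_Some_conv)
  have "((code K1, T1), (code K', T')) \<in> (step (machine m code p))\<^sup>*"
    using Suc.IH[OF _ _ _ d(2)] dstep_invariant[OF Suc.prems(1-3) d(1)] by blast
  then show ?case
    using machine_step[OF Suc.prems(1-3) d(1)] by (meson converse_rtrancl_into_rtrancl)
qed auto

lemma machine_halted: "(code [], T) \<notin> Domain (step (machine m code p))"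
  if "[] \<in> conts p []"
proof
  assume "(code [], T) \<in> Domain (step (machine m code p))"
  then obtain c where "((code [], T), c) \<in> step (machine m code p)"
    by blast
  from machine_step_lift[OF that this] show False
    by simp
qed

end

lemma Nil_in_conts: "K \<in> conts p K"
  by (induction p K rule: conts.induct) auto

definition start_tapes :: "nat \<Rightarrow> bool list \<Rightarrow> tape list" where
  "start_tapes m x = (word_on_tape x, 0) # replicate (m - 1) ((\<lambda>_. 0), 0)"

text \<open>Every computation path is the deterministic execution for some \<open>w\<close>, so a
  bound and a result known for all \<open>w\<close> carry over to all paths. The common state
  \<open>q\<close> is the code of the empty program.\<close>

theorem machine_exists:
  assumes "m \<ge> 1"
  shows "\<exists>M. wf_ntm M \<and> (\<forall>x B F. (\<forall>w. \<exists>t\<le>B. \<exists>w'. steps t (p, start_tapes m x, w) = Some ([], F w, w')) \<longrightarrow>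
    time_bounded M x B \<and> (\<exists>q. {c. halts_with M x c} = {(q, F w) |w. True}))"
proof -
  obtain f :: "instr list \<Rightarrow> nat" where f: "inj_on f (conts p [])"
    using finite_imp_inj_to_nat_seg[OF finite_conts] by blast
  \<comment> \<open>The whole program must receive the initial state \<open>0\<close>; the other
    continuations are shifted out of its way.\<close>
  define code where "code = (\<lambda>K. if K = p then 0 else Suc (f K))"
  have inj: "inj_on code (conts p [])"
    using f by (auto simp: inj_on_def code_def)
  have p0: "p \<in> conts p []" "code p = 0"
    using conts_start[of p "[]"] by (auto simp: code_def)
  let ?M = "machine m code p"
  have "time_bounded ?M x B \<and> {c. halts_with ?M x c} = {(code [], F w) |w. True}"
    if F: "\<forall>w. \<exists>t\<le>B. \<exists>w'. steps t (p, start_tapes m x, w) = Some ([], F w, w')" for x B F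
  proof -
    let ?T = "start_tapes m x"
    have init: "init_config ?M x = (code p, ?T)"
      by (simp add: init_config_def start_tapes_def p0 machine_def)
    have T: "length ?T = m" "symbols_ok ?T"
      using assms by (auto simp: start_tapes_def symbols_ok_def word_on_tape_def)
    have bounded: "k \<le> B \<and> (K' = [] \<longrightarrow> T' = F w)"
      if s: "steps k (p, ?T, w) = Some (K', T', w')" for k w K' T' w'
    proof -
      obtain t w1 where t: "t \<le> B" "steps t (p, ?T, w) = Some ([], F w, w1)"
        using F by blast
      \<comment> \<open>No step leaves the empty program, so an execution cannot outlast its halting
        time.\<close>
      have "k \<le> t"
      proof (rule ccontr)
        assume "\<not> k \<le> t"
        then obtain d where "k = t + Suc d"
          by (metis add_Suc_right less_imp_Suc_add not_le)
        then have "steps k (p, ?T, w) = Option.bind (Some ([], F w, w1)) (steps (Suc d))"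
          by (simp only: steps_add t(2))
        then show False
          using s by simp
      qed
      then obtain d where "t = k + d"
        using le_Suc_ex by blast
      then have "steps d (K', T', w') = Some ([], F w, w1)"
        using s t(2) unfolding \<open>t = k + d\<close> steps_add by simp
      then show ?thesis
        using \<open>k \<le> t\<close> t(1) by (cases d) auto
    qed
    have "time_bounded ?M x B"
      unfolding time_bounded_def init
    proof (intro allI impI)
      fix k c
      assume "((code p, ?T), c) \<in> step ?M ^^ k"
      then show "k \<le> B"
        using machine_path_lift[OF inj p0(1) T] bounded by blast
    qed
    moreover have "halts_with ?M x c \<longleftrightarrow> (\<exists>w. c = (code [], F w))" for c
    proof
      assume "halts_with ?M x c"
      then obtain k where k: "((code p, ?T), c) \<in> step ?M ^^ k" and c: "c \<notin> Domain (step ?M)"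
        unfolding halts_with_def init by (meson rtrancl_imp_relpow)
      obtain w K' T' w' where r: "c = (code K', T')" "steps k (p, ?T, w) = Some (K', T', w')"
          "K' \<in> conts p []" "length T' = m" "symbols_ok T'"
        using machine_path_lift[OF inj p0(1) T k] by blast
      have "K' = []"
      proof (rule ccontr)
        assume "K' \<noteq> []"
        then obtain K2 acts where "eff K' (map read_tape T') (w' 0) = Some (K2, acts)"
          using eff_total by blast
        then have "dstep (K', T', w') = Some (K2, map2 act_tape acts T', pop K' w')"
          by (simp add: dstep.simps)
        then show False
          using machine_step[OF inj r(3-5)] c r(1) by blast
      qed
      then show "\<exists>w. c = (code [], F w)"
        using bounded[OF r(2)] r(1) by blast
    next
      assume "\<exists>w. c = (code [], F w)"
      then obtain w where c: "c = (code [], F w)"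
        by blast
      obtain t w' where "steps t (p, ?T, w) = Some ([], F w, w')"
        using F by blast
      then show "halts_with ?M x c"
        unfolding halts_with_def init c
        using steps_machine[OF inj p0(1) T] machine_halted[OF inj Nil_in_conts] by blast
    qed
    ultimately show ?thesis
      by auto
  qed
  then show ?thesis
    using wf_machine[OF assms] by blast
qed

section \<open>Executing programs\<close>

text \<open>One \<open>t\<close> for all continuations \<open>K\<close> makes runs composable; a
  bound in place of an exact count lets branches share an estimate.\<close>

definition runs :: "instr list \<Rightarrow> tape list \<times> guesses \<Rightarrow> nat \<Rightarrow> tape list \<times> guesses \<Rightarrow> bool" where
  "runs p c B c' \<longleftrightarrow> (\<exists>t\<le>B. \<forall>K. steps t (p @ K, c) = Some (K, c'))"

lemma runs_mono: "runs p c B c' \<Longrightarrow> B \<le> B' \<Longrightarrow> runs p c B' c'"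
  unfolding runs_def by (meson order_trans)

lemma runs_Nil: "runs [] c B c"
  unfolding runs_def by (auto intro!: exI[of _ 0])

lemma runs_append:
  assumes "runs p c b1 c1" "runs q c1 b2 c2"
  shows "runs (p @ q) c (b1 + b2) c2"
proof -
  obtain t1 t2 where "t1 \<le> b1" "\<forall>K. steps t1 (p @ K, c) = Some (K, c1)"
    "t2 \<le> b2" "\<forall>K. steps t2 (q @ K, c1) = Some (K, c2)"
    using assms unfolding runs_def by blast
  then have "t1 + t2 \<le> b1 + b2 \<and> (\<forall>K. steps (t1 + t2) ((p @ q) @ K, c) = Some (K, c2))"
    by (simp add: steps_add)
  then show ?thesis
    unfolding runs_def by blast
qed

lemma runs_dstep:
  assumes "\<And>K. dstep (p @ K, c) = Some (r @ K, c1)" "runs r c1 b c2"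
  shows "runs p c (Suc b) c2"
proof -
  obtain t where "t \<le> b" "\<forall>K. steps t (r @ K, c1) = Some (K, c2)"
    using assms(2) unfolding runs_def by blast
  then have "Suc t \<le> Suc b \<and> (\<forall>K. steps (Suc t) (p @ K, c) = Some (K, c2))"
    by (simp add: assms(1))
  then show ?thesis
    unfolding runs_def by blast
qed

lemma act_tape_Stay: "act_tape (read_tape tp, Stay) tp = tp"
  by (simp add: act_tape_def read_tape_def)

lemma map2_stay: "map2 act_tape (stay (map read_tape T)) T = T"
  by (rule nth_equalityI) (simp_all add: act_tape_Stay)

lemma map2_stay_update:
  "map2 act_tape ((stay (map read_tape T))[k := a]) T = T[k := act_tape a (T ! k)]"
  by (rule nth_equalityI; cases "k < length T")
    (auto simp: nth_list_update act_tape_Stay list_update_beyond not_less)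

definition put :: "bool \<Rightarrow> tape \<Rightarrow> tape" where
  "put b tp = act_tape (symbol b, Right) tp"

definition mv :: "move \<Rightarrow> tape \<Rightarrow> tape" where
  "mv d tp = act_tape (read_tape tp, d) tp"

lemma runs_Put:
  assumes "runs q (T[k := put v (T ! k)], w) b c"
  shows "runs (Put k v # q) (T, w) (Suc b) c"
  using assms by (intro runs_dstep[where r = q]) (simp_all add: dstep.simps put_def map2_stay_update del: map_map)

lemma runs_Mv:
  assumes "k < length T" "runs q (T[k := mv d (T ! k)], w) b c"
  shows "runs (Mv k d # q) (T, w) (Suc b) c"
  using assms by (intro runs_dstep[where r = q]) (simp_all add: dstep.simps mv_def map2_stay_update del: map_map)

lemma runs_Cond:
  assumes "k < length T" "runs ((if read_tape (T ! k) = s then p1 else p2) @ q) (T, w) b c"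
  shows "runs (Cond k s p1 p2 # q) (T, w) (Suc b) c"
  using assms by (intro runs_dstep[OF _ assms(2)]) (simp_all add: dstep.simps map2_stay del: map_map)

lemma runs_Until_exit:
  assumes "k < length T" "read_tape (T ! k) = s" "runs q (T, w) b c"
  shows "runs (Until k s p # q) (T, w) (Suc b) c"
  using assms by (intro runs_dstep[OF _ assms(3)]) (simp_all add: dstep.simps map2_stay del: map_map)

lemma runs_Until_iter:
  assumes "k < length T" "read_tape (T ! k) \<noteq> s" "runs p (T, w) b1 (T1, w1)"
    "runs (Until k s p # q) (T1, w1) b2 c"
  shows "runs (Until k s p # q) (T, w) (Suc (b1 + b2)) c"
  using assms(1,2)
  by (intro runs_dstep[OF _ runs_append[OF assms(3,4)]]) (simp_all add: dstep.simps map2_stay del: map_map)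

lemma runs_Choose:
  assumes "runs ((if w 0 then p1 else p2) @ q) (T, \<lambda>i. w (Suc i)) b c"
  shows "runs (Choose p1 p2 # q) (T, w) (Suc b) c"
  using assms by (intro runs_dstep[OF _ assms]) (simp_all add: dstep.simps map2_stay del: map_map)

section \<open>Tapes holding words\<close>

text \<open>A zipper: the head scans the first bit of \<open>v\<close>, or the blank behind the word
  if \<open>v\<close> is empty.\<close>

definition zt :: "bool list \<Rightarrow> bool list \<Rightarrow> tape" where
  "zt u v = (word_on_tape (u @ v), int (length u))"

lemma word_on_tape_append:
  "word_on_tape (u @ b # v) (int (length u)) = symbol b"
  by (simp add: word_on_tape_def symbol_def nth_append)

lemma read_zt_Cons [simp]: "read_tape (zt u (b # v)) = symbol b"
  by (simp add: read_tape_def zt_def word_on_tape_append)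

lemma read_zt_Nil [simp]: "read_tape (zt u []) = 0"
  by (simp add: read_tape_def zt_def word_on_tape_def)

lemma put_zt_Cons [simp]: "put b (zt u (c # v)) = zt (u @ [b]) v"
proof -
  have "((word_on_tape (u @ c # v))(int (length u) := symbol b)) i = word_on_tape (u @ b # v) i" for i
    by (auto simp: word_on_tape_def symbol_def nth_append nth_Cons' nat_eq_iff)
  then show ?thesis
    by (simp add: put_def act_tape_def zt_def fun_eq_iff)
qed

lemma put_zt_Nil [simp]: "put b (zt u []) = zt (u @ [b]) []"
proof -
  have "((word_on_tape u)(int (length u) := symbol b)) i = word_on_tape (u @ [b]) i" for i
    by (auto simp: word_on_tape_def symbol_def nth_append nth_Cons' nat_eq_iff)
  then show ?thesis
    by (simp add: put_def act_tape_def zt_def fun_eq_iff)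
qed

lemma mv_eq: "mv d (f, i) = (f, i + offset d)"
  by (simp add: mv_def act_tape_def read_tape_def)

lemma mv_Right_zt [simp]: "mv Right (zt u (b # v)) = zt (u @ [b]) v"
  by (simp add: zt_def mv_eq)

lemma mv_Left_zt [simp]: "mv Left (zt (u @ [b]) v) = zt u (b # v)"
  by (simp add: zt_def mv_eq)

text \<open>A counter is the head position on a tape whose only symbol marks position \<open>0\<close>.\<close>

definition ct :: "nat \<Rightarrow> tape" where
  "ct k = (word_on_tape [False], int k)"

lemma read_ct [simp]: "read_tape (ct k) = (if k = 0 then 1 else 0)"
  by (simp add: ct_def read_tape_def word_on_tape_def)

lemma mv_Right_ct [simp]: "mv Right (ct k) = ct (Suc k)"
  by (simp add: ct_def mv_eq)

lemma mv_Left_ct [simp]: "mv Left (ct (Suc k)) = ct k"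
  by (simp add: ct_def mv_eq)

text \<open>Marking cell \<open>0\<close> and stepping back turns a blank tape into a
  counter.\<close>

lemma mv_Left_zt_ct: "mv Left (zt [False] []) = ct 0"
  by (simp add: ct_def zt_def mv_eq)

lemma symbol_simps [simp]: "symbol True = 2" "symbol False = 1"
  by (simp_all add: symbol_def)

lemma runs_Nil0: "runs [] c 0 c"
  by (rule runs_Nil)

text \<open>The pattern of most executions below: the rules compute the final configuration and the
  step bound as schematic variables, and the other two premises compare them with the stated
  ones.\<close>

lemma runs_eqI: "runs p c B c' \<Longrightarrow> c' = c'' \<Longrightarrow> B \<le> B' \<Longrightarrow> runs p c B' c''"
  using runs_mono by blast

text \<open>The tapes of the program: the input, the row of guesses being processed, five counters, and
  the output. Counter \<open>n\<close> holds the number of rows still to be written, \<open>a\<close> the number being read or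
  written, \<open>j\<close> is used for copying \<open>a\<close>, \<open>b\<close> counts pending subexpressions or the distance to move
  back on the input, and \<open>f\<close> flags a violated inclusion constraint.\<close>

definition st :: "bool list \<Rightarrow> bool list \<Rightarrow> tape \<Rightarrow> nat \<Rightarrow> nat \<Rightarrow> nat \<Rightarrow> nat \<Rightarrow> nat \<Rightarrow> bool list \<Rightarrow> tape list" where
  "st u v y n a j b f z = [zt u v, y, ct n, ct a, ct j, ct b, ct f, zt z []]"

lemma st_simps:
  "length (st u v y n a j b f z) = 8"
  "st u v y n a j b f z ! 0 = zt u v"
  "st u v y n a j b f z ! Suc 0 = y"
  "st u v y n a j b f z ! 2 = ct n"
  "st u v y n a j b f z ! 3 = ct a"
  "st u v y n a j b f z ! 4 = ct j"
  "st u v y n a j b f z ! 5 = ct b"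
  "st u v y n a j b f z ! 6 = ct f"
  "st u v y n a j b f z ! 7 = zt z []"
  "(st u v y n a j b f z)[0 := zt u' v'] = st u' v' y n a j b f z"
  "(st u v y n a j b f z)[Suc 0 := y'] = st u v y' n a j b f z"
  "(st u v y n a j b f z)[2 := ct k] = st u v y k a j b f z"
  "(st u v y n a j b f z)[3 := ct k] = st u v y n k j b f z"
  "(st u v y n a j b f z)[4 := ct k] = st u v y n a k b f z"
  "(st u v y n a j b f z)[5 := ct k] = st u v y n a j k f z"
  "(st u v y n a j b f z)[6 := ct k] = st u v y n a j b k z"
  "(st u v y n a j b f z)[7 := zt z' []] = st u v y n a j b f z'"
  by (simp_all add: st_def eval_nat_numeral)

text \<open>One rule per tape and action, each fitted to a syntactic shape of \<open>st\<close>;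
  repeated application of \<open>rule\<close> then acts as an interpreter.\<close>

named_theorems exec

lemma exec_Mv [exec]:
  "runs q (st (u @ [c]) v y n a j b f z, w) B d \<Longrightarrow> runs (Mv 0 Right # q) (st u (c # v) y n a j b f z, w) (Suc B) d"
  "runs q (st u v (zt (l @ [c]) r) n a j b f z, w) B d \<Longrightarrow> runs (Mv 1 Right # q) (st u v (zt l (c # r)) n a j b f z, w) (Suc B) d"
  "runs q (st u v y (Suc n) a j b f z, w) B d \<Longrightarrow> runs (Mv 2 Right # q) (st u v y n a j b f z, w) (Suc B) d"
  "runs q (st u v y n (Suc a) j b f z, w) B d \<Longrightarrow> runs (Mv 3 Right # q) (st u v y n a j b f z, w) (Suc B) d"
  "runs q (st u v y n a (Suc j) b f z, w) B d \<Longrightarrow> runs (Mv 4 Right # q) (st u v y n a j b f z, w) (Suc B) d"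
  "runs q (st u v y n a j (Suc b) f z, w) B d \<Longrightarrow> runs (Mv 5 Right # q) (st u v y n a j b f z, w) (Suc B) d"
  "runs q (st u v y n a j b (Suc f) z, w) B d \<Longrightarrow> runs (Mv 6 Right # q) (st u v y n a j b f z, w) (Suc B) d"
  "runs q (st u (c # v) y n a j b f z, w) B d \<Longrightarrow> runs (Mv 0 Left # q) (st (u @ [c]) v y n a j b f z, w) (Suc B) d"
  "runs q (st u v y n a j b f z, w) B d \<Longrightarrow> runs (Mv 2 Left # q) (st u v y (Suc n) a j b f z, w) (Suc B) d"
  "runs q (st u v y n a j b f z, w) B d \<Longrightarrow> runs (Mv 3 Left # q) (st u v y n (Suc a) j b f z, w) (Suc B) d"
  "runs q (st u v y n a j b f z, w) B d \<Longrightarrow> runs (Mv 4 Left # q) (st u v y n a (Suc j) b f z, w) (Suc B) d"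
  "runs q (st u v y n a j b f z, w) B d \<Longrightarrow> runs (Mv 5 Left # q) (st u v y n a j (Suc b) f z, w) (Suc B) d"
  "runs q (st u v y n a j b f z, w) B d \<Longrightarrow> runs (Mv 6 Left # q) (st u v y n a j b (Suc f) z, w) (Suc B) d"
  by (rule runs_Mv; simp add: st_simps)+

lemma exec_Put [exec]:
  "runs q (st u v y n a j b f (z @ [c]), w) B d \<Longrightarrow> runs (Put 7 c # q) (st u v y n a j b f z, w) (Suc B) d"
  "runs q (st u v (zt (l @ [c]) r) n a j b f z, w) B d \<Longrightarrow> runs (Put 1 c # q) (st u v (zt l (e # r)) n a j b f z, w) (Suc B) d"
  "runs q (st u v (zt (l @ [c]) []) n a j b f z, w) B d \<Longrightarrow> runs (Put 1 c # q) (st u v (zt l []) n a j b f z, w) (Suc B) d"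
  by (rule runs_Put; simp add: st_simps)+

lemma exec_exit [exec]:
  "runs q (st u (False # v) y n a j b f z, w) B d \<Longrightarrow>
    runs (Until 0 1 p # q) (st u (False # v) y n a j b f z, w) (Suc B) d"
  "runs q (st u v (zt l []) n a j b f z, w) B d \<Longrightarrow>
    runs (Until 1 0 p # q) (st u v (zt l []) n a j b f z, w) (Suc B) d"
  "runs q (st u v y 0 a j b f z, w) B d \<Longrightarrow> runs (Until 2 1 p # q) (st u v y 0 a j b f z, w) (Suc B) d"
  "runs q (st u v y n 0 j b f z, w) B d \<Longrightarrow> runs (Until 3 1 p # q) (st u v y n 0 j b f z, w) (Suc B) d"
  "runs q (st u v y n a 0 b f z, w) B d \<Longrightarrow> runs (Until 4 1 p # q) (st u v y n a 0 b f z, w) (Suc B) d"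
  "runs q (st u v y n a j 0 f z, w) B d \<Longrightarrow> runs (Until 5 1 p # q) (st u v y n a j 0 f z, w) (Suc B) d"
  by (rule runs_Until_exit; simp add: st_simps)+

lemma exec_iter [exec]:
  "runs p (st u (True # v) y n a j b f z, w) B1 (T, w1) \<Longrightarrow> runs (Until 0 1 p # q) (T, w1) B2 d \<Longrightarrow>
    runs (Until 0 1 p # q) (st u (True # v) y n a j b f z, w) (Suc (B1 + B2)) d"
  "runs p (st u v (zt l (c # r)) n a j b f z, w) B1 (T, w1) \<Longrightarrow> runs (Until 1 0 p # q) (T, w1) B2 d \<Longrightarrow>
    runs (Until 1 0 p # q) (st u v (zt l (c # r)) n a j b f z, w) (Suc (B1 + B2)) d"
  "runs p (st u v y (Suc n) a j b f z, w) B1 (T, w1) \<Longrightarrow> runs (Until 2 1 p # q) (T, w1) B2 d \<Longrightarrow>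
    runs (Until 2 1 p # q) (st u v y (Suc n) a j b f z, w) (Suc (B1 + B2)) d"
  "runs p (st u v y n (Suc a) j b f z, w) B1 (T, w1) \<Longrightarrow> runs (Until 3 1 p # q) (T, w1) B2 d \<Longrightarrow>
    runs (Until 3 1 p # q) (st u v y n (Suc a) j b f z, w) (Suc (B1 + B2)) d"
  "runs p (st u v y n a (Suc j) b f z, w) B1 (T, w1) \<Longrightarrow> runs (Until 4 1 p # q) (T, w1) B2 d \<Longrightarrow>
    runs (Until 4 1 p # q) (st u v y n a (Suc j) b f z, w) (Suc (B1 + B2)) d"
  "runs p (st u v y n a j (Suc b) f z, w) B1 (T, w1) \<Longrightarrow> runs (Until 5 1 p # q) (T, w1) B2 d \<Longrightarrow>
    runs (Until 5 1 p # q) (st u v y n a j (Suc b) f z, w) (Suc (B1 + B2)) d"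
  by (rule runs_Until_iter; simp add: st_simps symbol_def)+

lemma exec_Cond [exec]:
  "runs (p1 @ q) (st u (False # v) y n a j b f z, w) B d \<Longrightarrow>
    runs (Cond 0 1 p1 p2 # q) (st u (False # v) y n a j b f z, w) (Suc B) d"
  "runs (p2 @ q) (st u (True # v) y n a j b f z, w) B d \<Longrightarrow>
    runs (Cond 0 1 p1 p2 # q) (st u (True # v) y n a j b f z, w) (Suc B) d"
  "runs (p1 @ q) (st u v y n a j b 0 z, w) B d \<Longrightarrow>
    runs (Cond 6 1 p1 p2 # q) (st u v y n a j b 0 z, w) (Suc B) d"
  "runs (p2 @ q) (st u v y n a j b (Suc f) z, w) B d \<Longrightarrow>
    runs (Cond 6 1 p1 p2 # q) (st u v y n a j b (Suc f) z, w) (Suc B) d"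
  by (rule runs_Cond; simp add: st_simps symbol_def)+

text \<open>Kept out of \<open>exec\<close>: the scanned bit is an expression such as
  \<open>ys ! a\<close>, so its value has to be supplied at each use.\<close>

lemma exec_Cond_row:
  "c \<Longrightarrow> runs (p1 @ q) (st u v (zt l (c # r)) n a j b f z, w) B d \<Longrightarrow>
    runs (Cond 1 2 p1 p2 # q) (st u v (zt l (c # r)) n a j b f z, w) (Suc B) d"
  "\<not> c \<Longrightarrow> runs (p2 @ q) (st u v (zt l (c # r)) n a j b f z, w) B d \<Longrightarrow>
    runs (Cond 1 2 p1 p2 # q) (st u v (zt l (c # r)) n a j b f z, w) (Suc B) d"
  by (rule runs_Cond; simp add: st_simps symbol_def)+

lemmas exec_Nil [exec] = runs_Nil0

lemma enc_nat_simps: "enc_nat 0 = [False]" "enc_nat (Suc k) = True # enc_nat k"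
  by (simp_all add: enc_nat_def)

lemma length_enc_nat [simp]: "length (enc_nat k) = Suc k"
  by (simp add: enc_nat_def)

section \<open>The program\<close>

definition read_nat :: "instr list" where
  "read_nat = [Until 0 1 [Mv 0 Right, Mv 3 Right], Mv 0 Right]"

definition clear :: "instr list" where
  "clear = [Until 3 1 [Mv 3 Left]]"

definition emit_clear :: "instr list" where
  "emit_clear = [Until 3 1 [Mv 3 Left, Put 7 True], Put 7 False]"

text \<open>A counter can only be tested for zero. To emit its value and keep it, its units are
  moved to a second counter and back.\<close>

definition emit_count :: "instr list" where
  "emit_count = [Until 3 1 [Mv 3 Left, Mv 4 Right, Put 7 True], Until 4 1 [Mv 4 Left, Mv 3 Right], Put 7 False]"

lemma runs_read_nat:
  "runs read_nat (st u (enc_nat k @ v) y n a j b f z, w) (3 * k + 2) (st (u @ enc_nat k) v y n (a + k) j b f z, w)"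
  unfolding read_nat_def
proof (induction k arbitrary: u a)
  case 0
  show ?case
    unfolding enc_nat_simps append.simps by (rule runs_eqI, (rule exec)+) simp_all
next
  case (Suc k)
  show ?case
    unfolding enc_nat_simps append.simps by (rule runs_eqI, (rule exec Suc)+) simp_all
qed

lemma runs_clear: "runs clear (st u v y n a j b f z, w) (2 * a + 1) (st u v y n 0 j b f z, w)"
  unfolding clear_def
proof (induction a)
  case 0
  show ?case
    by (rule runs_eqI, (rule exec)+) simp_all
next
  case (Suc a)
  show ?case
    by (rule runs_eqI, (rule exec Suc)+) simp_all
qed

lemma runs_emit_clear:
  "runs emit_clear (st u v y n a j b f z, w) (3 * a + 2) (st u v y n 0 j b f (z @ enc_nat a), w)"
  unfolding emit_clear_def
proof (induction a arbitrary: z)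
  case 0
  show ?case
    unfolding enc_nat_simps by (rule runs_eqI, (rule exec)+) simp_all
next
  case (Suc a)
  show ?case
    unfolding enc_nat_simps by (rule runs_eqI, (rule exec Suc)+) simp_all
qed

lemma runs_emit_count:
  "runs emit_count (st u v y n a 0 b f z, w) (7 * a + 3) (st u v y n a 0 b f (z @ enc_nat a), w)"
proof -
  have restore: "runs [Until 4 1 [Mv 4 Left, Mv 3 Right], Put 7 False] (st u v y n i j b f z, w) (3 * j + 2)
      (st u v y n (i + j) 0 b f (z @ [False]), w)" for i j z
  proof (induction j arbitrary: i)
    case 0
    show ?case
      by (rule runs_eqI, (rule exec)+) simp_all
  next
    case (Suc j)
    show ?case
      by (rule runs_eqI, (rule exec Suc)+) simp_all
  qed
  \<comment> \<open>Generalised to \<open>j\<close> units moved already. A unit takes four steps to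
    move and emit and three to bring back, hence seven when \<open>j = 0\<close>.\<close>
  have "runs emit_count (st u v y n i j b f z, w) (4 * i + 3 * (i + j) + 3)
      (st u v y n (i + j) 0 b f (z @ enc_nat i), w)" for i j z
    unfolding emit_count_def
  proof (induction i arbitrary: j z)
    case 0
    show ?case
      unfolding enc_nat_simps by (rule runs_eqI, (rule exec_exit restore)+) simp_all
  next
    case (Suc i)
    show ?case
      unfolding enc_nat_simps by (rule runs_eqI, (rule exec Suc)+) simp_all
  qed
  from this[of a 0 z] show ?thesis
    by (simp add: algebra_simps)
qed

section \<open>Moving along the row and copying regular expressions\<close>

definition rewind :: "instr list" where
  "rewind = [Mv 1 Left, Until 1 0 [Mv 1 Left], Mv 1 Right]"

text \<open>The cells laid out on tape \<open>1\<close> bound the later loops over all labels, which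
  run until the blank behind them.\<close>

definition read_size :: "instr list" where
  "read_size = [Until 0 1 [Mv 0 Right, Mv 3 Right, Mv 2 Right, Put 1 False], Mv 0 Right]"

text \<open>The tags in \<open>enc_rexp\<close> are unary, so reading a tag bit by bit is itself the
  case distinction.\<close>

primrec copy_case :: "instr list list \<Rightarrow> instr list" where
  "copy_case [] = []"
| "copy_case (p # ps) =
     [Cond 0 1 (Mv 0 Right # Put 7 False # p) (Mv 0 Right # Put 7 True # copy_case ps)]"

text \<open>In prefix notation the stack of a recursive descent holds only identical tasks, namely
  to copy one more expression, and shrinks to a number. A tag replaces one task by as many as its
  constructor has subexpressions.\<close>

definition copy_loop :: "instr list" where
  "copy_loop = [Until 5 1 (Mv 5 Left # copy_case
     [[], [], read_nat @ emit_clear, [Mv 5 Right, Mv 5 Right], [Mv 5 Right, Mv 5 Right], [Mv 5 Right]])]"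

text \<open>The row is addressed by walking it in step with a unary number on the input. The input
  bits passed are counted because the constraints are read again for every row.\<close>

definition seek :: "instr list" where
  "seek = [Until 0 1 [Mv 0 Right, Mv 5 Right, Mv 1 Right], Mv 0 Right, Mv 5 Right]"

lemma runs_rewind:
  "runs rewind (st u v (zt l r) n a j b f z, w) (2 * length l + 3) (st u v (zt [] (l @ r)) n a j b f z, w)"
proof -
  define ys where "ys = l @ r"
  \<comment> \<open>The blank is found at position \<open>-1\<close>, which \<open>zt\<close> cannot
    express; hence the raw head positions.\<close>
  have loop: "runs [Until 1 0 [Mv 1 Left], Mv 1 Right] (st u v (word_on_tape ys, int i - 1) n a j b f z, w)
      (2 * i + 2) (st u v (zt [] ys) n a j b f z, w)" if "i \<le> length ys" for i
    using that
  proof (induction i)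
    case 0
    have "runs [Mv 1 Right] (st u v (word_on_tape ys, - 1) n a j b f z, w) 1
        (st u v (zt [] ys) n a j b f z, w)"
      unfolding One_nat_def
      by (rule runs_Mv) (simp_all add: st_simps mv_eq zt_def runs_Nil)
    moreover have "read_tape (word_on_tape ys, - 1) = 0"
      by (simp add: read_tape_def word_on_tape_def)
    ultimately have "runs [Until 1 0 [Mv 1 Left], Mv 1 Right] (st u v (word_on_tape ys, - 1) n a j b f z, w)
        (Suc 1) (st u v (zt [] ys) n a j b f z, w)"
      by (intro runs_Until_exit) (simp_all add: st_simps)
    then show ?case
      by (simp add: numeral_2_eq_2)
  next
    case (Suc i)
    have "runs [Mv 1 Left] (st u v (word_on_tape ys, int (Suc i) - 1) n a j b f z, w) 1
        (st u v (word_on_tape ys, int i - 1) n a j b f z, w)"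
      unfolding One_nat_def
      by (rule runs_Mv) (simp_all add: st_simps mv_eq runs_Nil)
    moreover have "read_tape (st u v (word_on_tape ys, int (Suc i) - 1) n a j b f z ! 1) \<noteq> 0"
      using Suc.prems by (simp add: st_simps read_tape_def word_on_tape_def)
    moreover have "runs [Until 1 0 [Mv 1 Left], Mv 1 Right] (st u v (word_on_tape ys, int i - 1) n a j b f z, w)
      (2 * i + 2) (st u v (zt [] ys) n a j b f z, w)"
      using Suc by simp
    ultimately have "runs [Until 1 0 [Mv 1 Left], Mv 1 Right] (st u v (word_on_tape ys, int (Suc i) - 1) n a j b f z, w)
       (Suc (1 + (2 * i + 2))) (st u v (zt [] ys) n a j b f z, w)"
      by (intro runs_Until_iter) (simp_all add: st_simps)
    then show ?case
      by (rule runs_eqI) simp_all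
  qed
  have "runs rewind (st u v (zt l r) n a j b f z, w) (Suc (2 * length l + 2)) (st u v (zt [] ys) n a j b f z, w)"
    unfolding rewind_def
    by (rule runs_Mv) (use loop[of "length l"] in \<open>simp_all add: st_simps mv_eq zt_def ys_def\<close>)
  then show ?thesis
    by (simp add: ys_def numeral_3_eq_3)
qed

lemma runs_read_size:
  "runs read_size (st u (enc_nat k @ v) (zt l []) n a j b f z, w) (5 * k + 2)
    (st (u @ enc_nat k) v (zt (l @ replicate k False) []) (n + k) (a + k) j b f z, w)"
  unfolding read_size_def
proof (induction k arbitrary: u l n a)
  case 0
  show ?case
    unfolding enc_nat_simps append.simps by (rule runs_eqI, (rule exec)+) simp_all
next
  case (Suc k)
  show ?case
    unfolding enc_nat_simps append.simps by (rule runs_eqI, (rule exec Suc)+) simp_all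
qed

lemma runs_copy_case:
  assumes "k < length ps"
    "runs (ps ! k) (st (u @ enc_nat k) v y n a j b f (z @ enc_nat k), w) B c"
  shows "runs (copy_case ps) (st u (enc_nat k @ v) y n a j b f z, w) (3 * k + 3 + B) c"
  using assms
proof (induction k arbitrary: ps u z)
  case 0
  then obtain p qs where ps: "ps = p # qs"
    by (cases ps) auto
  have "runs (Mv 0 Right # Put 7 False # p) (st u (enc_nat 0 @ v) y n a j b f z, w) (Suc (Suc B)) c"
    using 0 unfolding enc_nat_simps append.simps by (intro exec) (simp add: ps)
  then show ?case
    unfolding ps enc_nat_simps append.simps copy_case.simps
    by - (rule runs_mono, rule exec_Cond, simp, simp)
next
  case (Suc k)
  then obtain p qs where ps: "ps = p # qs"
    by (cases ps) auto
  have "runs (Mv 0 Right # Put 7 True # copy_case qs) (st u (enc_nat (Suc k) @ v) y n a j b f z, w)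
      (Suc (Suc (3 * k + 3 + B))) c"
    using Suc.prems unfolding enc_nat_simps append.simps
    by (intro exec Suc.IH) (simp_all add: ps enc_nat_simps)
  then show ?case
    unfolding ps enc_nat_simps append.simps copy_case.simps
    by - (rule runs_mono, rule exec_Cond, simp, simp)
qed

lemmas macros =
  runs_read_nat runs_clear runs_emit_clear runs_emit_count runs_rewind runs_read_size
  runs_append[OF runs_read_nat] runs_append[OF runs_clear] runs_append[OF runs_emit_clear]
  runs_append[OF runs_emit_count] runs_append[OF runs_rewind] runs_append[OF runs_read_size]

text \<open>Copying \<open>r\<close> is spread over several iterations and is not the run of a
  subprogram. The statement therefore extends a given run of the whole remaining loop at its
  front.\<close>

lemma runs_copy_loop:
  assumes "runs copy_loop (st (u @ enc_rexp r) v y n 0 0 b f (z @ enc_rexp r), w) B c"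
  shows "runs copy_loop (st u (enc_rexp r @ v) y n 0 0 (Suc b) f z, w) (B + 10 * length (enc_rexp r)) c"
proof -
  have iter: "runs copy_loop (st u (enc_nat k @ v) y n 0 0 (Suc b) f z, w) (Suc (Suc (3 * k + 3 + B1) + B)) c"
    if "k < 6" "runs copy_loop (T, w) B c"
      "runs ([[], [], read_nat @ emit_clear, [Mv 5 Right, Mv 5 Right], [Mv 5 Right, Mv 5 Right], [Mv 5 Right]] ! k)
        (st (u @ enc_nat k) v y n 0 0 b f (z @ enc_nat k), w) B1 (T, w)"
    for k u v b z B B1 T
    using that(2) unfolding copy_loop_def
    by (intro exec_iter exec_Mv runs_copy_case) (use that in \<open>simp_all\<close>)
  have binary: "runs copy_loop (st u (enc @ v) y n 0 0 (Suc b) f z, w) (B + 10 * length enc) c"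
    if IH: "\<And>u v b z B. runs copy_loop (st (u @ enc_rexp r) v y n 0 0 b f (z @ enc_rexp r), w) B c \<Longrightarrow>
        runs copy_loop (st u (enc_rexp r @ v) y n 0 0 (Suc b) f z, w) (B + 10 * length (enc_rexp r)) c"
      "\<And>u v b z B. runs copy_loop (st (u @ enc_rexp s) v y n 0 0 b f (z @ enc_rexp s), w) B c \<Longrightarrow>
        runs copy_loop (st u (enc_rexp s @ v) y n 0 0 (Suc b) f z, w) (B + 10 * length (enc_rexp s)) c"
      and enc: "enc = enc_nat k @ enc_rexp r @ enc_rexp s" "k = 3 \<or> k = 4"
      and prem: "runs copy_loop (st (u @ enc) v y n 0 0 b f (z @ enc), w) B c"
    for k r s enc u v b z B
  proof -
    \<comment> \<open>The run is built from its end: \<open>s\<close> is copied after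
      \<open>r\<close>, so its hypothesis is applied first.\<close>
    have "runs copy_loop (st (u @ enc_nat k @ enc_rexp r) (enc_rexp s @ v) y n 0 0 (Suc b) f
        (z @ enc_nat k @ enc_rexp r), w) (B + 10 * length (enc_rexp s)) c"
      by (rule IH(2)) (use prem in \<open>simp add: enc\<close>)
    then have "runs copy_loop (st (u @ enc_nat k) (enc_rexp r @ enc_rexp s @ v) y n 0 0 (Suc (Suc b)) f
        (z @ enc_nat k), w) (B + 10 * length (enc_rexp s) + 10 * length (enc_rexp r)) c"
      by (intro IH(1)) simp
    moreover have "runs [Mv 5 Right, Mv 5 Right]
        (st (u @ enc_nat k) (enc_rexp r @ enc_rexp s @ v) y n 0 0 b f (z @ enc_nat k), w) 2
        (st (u @ enc_nat k) (enc_rexp r @ enc_rexp s @ v) y n 0 0 (Suc (Suc b)) f (z @ enc_nat k), w)"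
      by (rule runs_eqI, (rule exec)+) simp_all
    ultimately have "runs copy_loop (st u (enc_nat k @ enc_rexp r @ enc_rexp s @ v) y n 0 0 (Suc b) f z, w)
        (Suc (Suc (3 * k + 3 + 2) + (B + 10 * length (enc_rexp s) + 10 * length (enc_rexp r)))) c"
      using enc(2) by (intro iter) auto
    then have "runs copy_loop (st u (enc @ v) y n 0 0 (Suc b) f z, w)
        (Suc (Suc (3 * k + 3 + 2) + (B + 10 * length (enc_rexp s) + 10 * length (enc_rexp r)))) c"
      by (simp add: enc(1))
    then show ?thesis
      by (rule runs_mono) (use enc in auto)
  qed
  show ?thesis
    using assms
  proof (induction r arbitrary: u v b z B)
    case Zero
    show ?case
      unfolding enc_rexp.simps
      by (rule runs_mono, rule iter[OF _ Zero[unfolded enc_rexp.simps], where ?B1.0 = 0])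
        (simp_all add: runs_Nil)
  next
    case One
    show ?case
      unfolding enc_rexp.simps
      by (rule runs_mono, rule iter[OF _ One[unfolded enc_rexp.simps], where ?B1.0 = 0])
        (simp_all add: runs_Nil)
  next
    case (Atom a)
    have "runs (read_nat @ emit_clear) (st (u @ enc_nat 2) (enc_nat a @ v) y n 0 0 b f (z @ enc_nat 2), w)
        (6 * a + 4) (st (u @ enc_rexp (Atom a)) v y n 0 0 b f (z @ enc_rexp (Atom a)), w)"
      by (rule runs_eqI, (rule macros)+) simp_all
    then have "runs copy_loop (st u (enc_nat 2 @ enc_nat a @ v) y n 0 0 (Suc b) f z, w)
        (Suc (Suc (3 * 2 + 3 + (6 * a + 4)) + B)) c"
      by (intro iter[OF _ Atom]) simp_all
    then show ?case
      by (auto elim: runs_mono)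
  next
    case (Plus r s)
    show ?case
      by (rule binary[where k = 3, OF Plus.IH]) (use Plus.prems in simp_all)
  next
    case (Times r s)
    show ?case
      by (rule binary[where k = 4, OF Times.IH]) (use Times.prems in simp_all)
  next
    case (Star r)
    have "runs copy_loop (st (u @ enc_nat 5) (enc_rexp r @ v) y n 0 0 (Suc b) f (z @ enc_nat 5), w)
        (B + 10 * length (enc_rexp r)) c"
      by (rule Star.IH) (use Star.prems in simp)
    moreover have "runs [Mv 5 Right] (st (u @ enc_nat 5) (enc_rexp r @ v) y n 0 0 b f (z @ enc_nat 5), w) 1
        (st (u @ enc_nat 5) (enc_rexp r @ v) y n 0 0 (Suc b) f (z @ enc_nat 5), w)"
      by (rule runs_eqI, (rule exec)+) simp_all
    ultimately have "runs copy_loop (st u (enc_nat 5 @ enc_rexp r @ v) y n 0 0 (Suc b) f z, w)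
        (Suc (Suc (3 * 5 + 3 + 1) + (B + 10 * length (enc_rexp r)))) c"
      by (intro iter) simp_all
    then show ?case
      by (auto elim: runs_mono)
  qed
qed

lemma runs_copy_rexp:
  "runs (Mv 5 Right # copy_loop) (st u (enc_rexp r @ v) y n 0 0 0 f z, w) (10 * length (enc_rexp r) + 2)
    (st (u @ enc_rexp r) v y n 0 0 0 f (z @ enc_rexp r), w)"
proof -
  have "runs copy_loop (st (u @ enc_rexp r) v y n 0 0 0 f (z @ enc_rexp r), w) 1
      (st (u @ enc_rexp r) v y n 0 0 0 f (z @ enc_rexp r), w)"
    unfolding copy_loop_def by (rule runs_eqI, (rule exec)+) simp_all
  from runs_copy_loop[OF this] show ?thesis
    by - (rule runs_eqI, (rule exec, assumption)+, simp_all)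
qed

text \<open>The bit that announces an entry in \<open>enc_list\<close> is the test of one iteration.
  If the body is linear in its entry, the loop is linear in the code of the list; the increment of
  \<open>c\<close> pays for the test.\<close>

lemma runs_enc_list:
  assumes "\<And>x u v z. x \<in> set xs \<Longrightarrow> runs p (st u (True # e x @ v) y n a j b f z, w) (c * length (e x) + c)
    (st (u @ True # e x) v y n a j b f (z @ g x), w)"
  shows "runs [Until 0 1 p, Mv 0 Right] (st u (enc_list e xs @ v) y n a j b f z, w)
    (Suc c * length (enc_list e xs) + 1) (st (u @ enc_list e xs) v y n a j b f (z @ concat (map g xs)), w)"
  using assms
proof (induction xs arbitrary: u z)
  case Nil
  show ?case
    unfolding enc_list.simps append.simps by (rule runs_eqI, (rule exec)+) simp_all
next
  case (Cons x xs)
  have "runs p (st u (True # e x @ enc_list e xs @ v) y n a j b f z, w) (c * length (e x) + c)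
    (st (u @ True # e x) (enc_list e xs @ v) y n a j b f (z @ g x), w)"
    by (rule Cons.prems) simp
  moreover have "runs [Until 0 1 p, Mv 0 Right] (st (u @ True # e x) (enc_list e xs @ v) y n a j b f (z @ g x), w)
    (Suc c * length (enc_list e xs) + 1)
    (st ((u @ True # e x) @ enc_list e xs) v y n a j b f ((z @ g x) @ concat (map g xs)), w)"
    by (rule Cons.IH) (use Cons.prems in simp)
  ultimately show ?case
    unfolding enc_list.simps append.simps append_assoc
    by - (rule runs_eqI, rule exec_iter, assumption+, simp_all add: algebra_simps)
qed

section \<open>Writing the transducer and the key labels\<close>

definition terminals_part :: "instr list" where
  "terminals_part = [Until 0 1 (Mv 0 Right # Put 7 True # read_nat @ emit_count @ emit_clear @
     [Put 7 True, Put 7 False]), Mv 0 Right]"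

definition prods_part :: "instr list" where
  "prods_part = [Until 0 1 (Mv 0 Right # Put 7 True # read_nat @ emit_count @ emit_clear @
     Mv 5 Right # copy_loop), Mv 0 Right]"

definition keys_part :: "instr list" where
  "keys_part = [Until 0 1 [Mv 0 Right, Cond 0 1 (Mv 0 Right # Put 7 True # read_nat @ emit_clear)
     (Mv 0 Right # read_nat @ clear @ read_nat @ clear)], Mv 0 Right]"

lemma enc_One: "enc_rexp One = [True, False]"
  by (simp add: enc_nat_def)

text \<open>The closing bit of the list is not emitted yet, because the productions continue the
  same list. \<open>One\<close> forces terminal nodes to be leaves.\<close>

lemma runs_terminals_part:
  "runs terminals_part (st u (enc_list enc_nat ts @ v) y n 0 0 0 f z, w)
    (21 * length (enc_list enc_nat ts) + 1)
    (st (u @ enc_list enc_nat ts) v y n 0 0 0 f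
      (z @ concat (map (\<lambda>a. True # enc_nat a @ enc_nat a @ enc_rexp One) ts)), w)"
proof -
  have "runs (Mv 0 Right # Put 7 True # read_nat @ emit_count @ emit_clear @ [Put 7 True, Put 7 False])
    (st u (True # enc_nat a @ v) y n 0 0 0 f z, w) (20 * length (enc_nat a) + 20)
    (st (u @ True # enc_nat a) v y n 0 0 0 f (z @ True # enc_nat a @ enc_nat a @ enc_rexp One), w)" for a u v z
    unfolding enc_One by (rule runs_eqI, (rule exec macros)+) simp_all
  from runs_enc_list[OF this] show ?thesis
    unfolding terminals_part_def by simp
qed

lemma runs_prods_part:
  "runs prods_part (st u (enc_list (enc_pair enc_nat enc_rexp) ps @ v) y n 0 0 0 f z, w)
    (21 * length (enc_list (enc_pair enc_nat enc_rexp) ps) + 1)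
    (st (u @ enc_list (enc_pair enc_nat enc_rexp) ps) v y n 0 0 0 f
      (z @ concat (map (\<lambda>(a, r). True # enc_nat a @ enc_nat a @ enc_rexp r) ps)), w)"
proof -
  have "runs (Mv 0 Right # Put 7 True # read_nat @ emit_count @ emit_clear @ Mv 5 Right # copy_loop)
    (st u (True # enc_nat a @ enc_rexp r @ v) y n 0 0 0 f z, w) (20 * length (enc_nat a @ enc_rexp r) + 20)
    (st (u @ True # enc_nat a @ enc_rexp r) v y n 0 0 0 f (z @ True # enc_nat a @ enc_nat a @ enc_rexp r), w)"
    for a r u v z
    by (rule runs_eqI, (rule runs_copy_rexp exec macros)+) simp_all
  then have "runs (Mv 0 Right # Put 7 True # read_nat @ emit_count @ emit_clear @ Mv 5 Right # copy_loop)
    (st u (True # enc_pair enc_nat enc_rexp x @ v) y n 0 0 0 f z, w) (20 * length (enc_pair enc_nat enc_rexp x) + 20)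
    (st (u @ True # enc_pair enc_nat enc_rexp x) v y n 0 0 0 f
      (z @ (case x of (a, r) \<Rightarrow> True # enc_nat a @ enc_nat a @ enc_rexp r)), w)"
    for x u v z
    by (simp add: enc_pair_def case_prod_beta)
  from runs_enc_list[OF this] show ?thesis
    unfolding prods_part_def by simp
qed

primrec key_code :: "constr \<Rightarrow> bool list" where
  "key_code (Key a) = True # enc_nat a"
| "key_code (Incl a b) = []"

lemma runs_keys_part:
  "runs keys_part (st u (enc_list enc_constr C @ v) y n 0 0 0 f z, w)
    (21 * length (enc_list enc_constr C) + 1)
    (st (u @ enc_list enc_constr C) v y n 0 0 0 f (z @ concat (map key_code C)), w)"
proof -
  have "runs [Mv 0 Right, Cond 0 1 (Mv 0 Right # Put 7 True # read_nat @ emit_clear)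
     (Mv 0 Right # read_nat @ clear @ read_nat @ clear)]
    (st u (True # enc_constr x @ v) y n 0 0 0 f z, w) (20 * length (enc_constr x) + 20)
    (st (u @ True # enc_constr x) v y n 0 0 0 f (z @ key_code x), w)" for x u v z
  proof (cases x)
    case (Key a)
    show ?thesis
      unfolding Key enc_constr.simps key_code.simps append.simps
      by (rule runs_eqI, (rule exec macros | unfold append_assoc append.simps append_Nil2)+) simp_all
  next
    case (Incl a c)
    show ?thesis
      unfolding Incl enc_constr.simps key_code.simps append.simps append_assoc
      by (rule runs_eqI, (rule exec macros | unfold append_assoc append.simps append_Nil2)+) simp_all
  qed
  from runs_enc_list[OF this] show ?thesis
    unfolding keys_part_def by simp
qed

definition outs_part :: "instr list" where
  "outs_part = [Until 1 0 (Put 7 True # emit_count @ emit_count @ emit_count @ [Mv 3 Right, Mv 1 Right])]"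

text \<open>Counter \<open>3\<close> follows the head on the row and so holds the current label. The
  bound \<open>m\<close> makes the cost of a cell independent of its position.\<close>

lemma runs_outs_part:
  assumes "length l + length r \<le> m"
  shows "runs outs_part (st u v (zt l r) n (length l) 0 b f z, w) (length r * (21 * m + 14) + 1)
    (st u v (zt (l @ r) []) n (length l + length r) 0 b f (z @ concat
      (map (\<lambda>i. True # enc_nat i @ enc_nat i @ enc_nat i) [length l..<length l + length r])), w)"
  using assms unfolding outs_part_def
proof (induction r arbitrary: l z)
  case Nil
  show ?case
    by (rule runs_eqI, (rule exec)+) simp_all
next
  case (Cons c r)
  have "runs (Put 7 True # emit_count @ emit_count @ emit_count @ [Mv 3 Right, Mv 1 Right])
      (st u v (zt l (c # r)) n (length l) 0 b f z, w) (21 * m + 13)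
      (st u v (zt (l @ [c]) r) n (length (l @ [c])) 0 b f
        (z @ True # enc_nat (length l) @ enc_nat (length l) @ enc_nat (length l)), w)"
    by (rule runs_eqI, (rule exec macros)+) (use Cons.prems in simp_all)
  note iter = exec_iter(2)[OF this Cons.IH]
  show ?case
    by (rule runs_eqI[OF iter]) (use Cons.prems in \<open>simp_all add: upt_conv_Cons del: upt_Suc\<close>)
qed

text \<open>The only source of nondeterminism in the program. Each chosen label is emitted at once;
  the row keeps the bits so that the constraints can be looked up afterwards.\<close>

definition row_part :: "instr list" where
  "row_part = [Until 1 0 [Choose ([Put 1 True, Put 7 True] @ emit_count) [Put 1 False], Mv 3 Right]]"

lemma runs_row_part:
  assumes "length l + length r \<le> m"
  shows "runs row_part (st u v (zt l r) n (length l) 0 b f z, w) (length r * (7 * m + 8) + 1)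
    (st u v (zt (l @ map w [0..<length r]) []) n (length l + length r) 0 b f (z @ concat
      (map (\<lambda>i. True # enc_nat i) (filter (\<lambda>i. w (i - length l)) [length l..<length l + length r]))),
     \<lambda>i. w (i + length r))"
  using assms unfolding row_part_def
proof (induction r arbitrary: l z w)
  case Nil
  show ?case
    by (rule runs_eqI, (rule exec)+) simp_all
next
  case (Cons c r)
  have "runs [Choose ([Put 1 True, Put 7 True] @ emit_count) [Put 1 False], Mv 3 Right]
      (st u v (zt l (c # r)) n (length l) 0 b f z, w) (7 * m + 7)
      (st u v (zt (l @ [w 0]) r) n (length (l @ [w 0])) 0 b f
        (z @ (if w 0 then True # enc_nat (length l) else [])), \<lambda>i. w (Suc i))"
  proof (cases "w 0")
    case True
    have "runs (([Put 1 True, Put 7 True] @ emit_count) @ [Mv 3 Right])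
      (st u v (zt l (c # r)) n (length l) 0 b f z, \<lambda>i. w (Suc i)) (7 * m + 6)
      (st u v (zt (l @ [w 0]) r) n (length (l @ [w 0])) 0 b f
        (z @ (if w 0 then True # enc_nat (length l) else [])), \<lambda>i. w (Suc i))"
      unfolding append.simps
      by (rule runs_eqI, (rule exec macros)+) (use True Cons.prems in simp_all)
    then show ?thesis
      by - (rule runs_eqI, rule runs_Choose, use True in simp, use True in simp_all)
  next
    case False
    have "runs ([Put 1 False] @ [Mv 3 Right])
      (st u v (zt l (c # r)) n (length l) 0 b f z, \<lambda>i. w (Suc i)) (7 * m + 6)
      (st u v (zt (l @ [w 0]) r) n (length (l @ [w 0])) 0 b f
        (z @ (if w 0 then True # enc_nat (length l) else [])), \<lambda>i. w (Suc i))"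
      unfolding append.simps
      by (rule runs_eqI, (rule exec macros)+) (use False Cons.prems in simp_all)
    then show ?thesis
      by - (rule runs_eqI, rule runs_Choose, use False in simp, use False in simp_all)
  qed
  note iter = exec_iter(2)[OF this Cons.IH]
  have upt: "map w [0..<Suc k] = w 0 # map (\<lambda>i. w (Suc i)) [0..<k]" for k
    by (simp add: upt_conv_Cons map_Suc_upt[symmetric] del: upt_Suc)
  have filt: "filter (\<lambda>i. w (i - length l)) [length l..<length l + Suc k] =
      (if w 0 then [length l] else []) @
      filter (\<lambda>i. w (Suc (i - Suc (length l)))) [Suc (length l)..<Suc (length l) + k]" for k
  proof -
    have "filter (\<lambda>i. w (i - length l)) [Suc (length l)..<Suc (length l) + k] =
        filter (\<lambda>i. w (Suc (i - Suc (length l)))) [Suc (length l)..<Suc (length l) + k]"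
      by (rule filter_cong) (auto simp: Suc_diff_Suc)
    then show ?thesis
      by (simp add: upt_conv_Cons del: upt_Suc)
  qed
  show ?case
    by (rule runs_eqI[OF iter])
      (use Cons.prems filt[of "length r"] upt[of "length r"] in \<open>simp_all del: upt_Suc\<close>)
qed

lemma enc_list_concat: "enc_list e xs = concat (map (\<lambda>x. True # e x) xs) @ [False]"
  by (induction xs) simp_all

section \<open>Checking a guessed letter against the inclusion constraints\<close>

lemma runs_seek_zipper:
  "runs seek (st u (enc_nat (length s) @ v) (zt l (s @ r)) n a j b f z, w) (4 * length s + 4)
    (st (u @ enc_nat (length s)) v (zt (l @ s) r) n a j (b + Suc (length s)) f z, w)"
  unfolding seek_def
proof (induction s arbitrary: u l b)
  case Nil
  show ?case
    unfolding list.size enc_nat_simps append.simps by (rule runs_eqI, (rule exec)+) simp_all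
next
  case (Cons c s)
  show ?case
    unfolding list.size add_0_right add_Suc_right enc_nat_simps append.simps
    by (rule runs_eqI, (rule exec Cons)+) simp_all
qed

lemma runs_seek:
  assumes "k < length ys"
  shows "runs seek (st u (enc_nat k @ v) (zt [] ys) n a j b f z, w) (4 * k + 4)
    (st (u @ enc_nat k) v (zt (take k ys) (ys ! k # drop (Suc k) ys)) n a j (b + Suc k) f z, w)"
  using assms runs_seek_zipper[of u "take k ys" v "[]" "ys ! k # drop (Suc k) ys"]
  by (simp add: id_take_nth_drop[symmetric])

lemma runs_rewind_from:
  assumes "k < length ys"
  shows "runs rewind (st u v (zt (take k ys) (ys ! k # drop (Suc k) ys)) n a j b f z, w) (2 * k + 3)
    (st u v (zt [] ys) n a j b f z, w)"
  using assms runs_rewind[of u v "take k ys" "ys ! k # drop (Suc k) ys"]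
  by (simp add: id_take_nth_drop[symmetric])

text \<open>Every move on the input is paid into counter \<open>5\<close>, to be undone by
  \<open>return_part\<close>. The second label is passed even if the first is not in the row, since
  the input has to be consumed. The flag is raised only from \<open>0\<close>, so it stays Boolean
  across all constraints.\<close>

definition check_constr :: "instr list" where
  "check_constr = [Mv 0 Right, Mv 5 Right, Cond 0 1 (Mv 0 Right # Mv 5 Right # seek @ rewind)
     (Mv 0 Right # Mv 5 Right # seek @ [Cond 1 2
        (rewind @ seek @ Cond 1 2 [] [Cond 6 1 [Mv 6 Right] []] # rewind)
        (rewind @ seek @ rewind)])]"

primrec violated :: "bool list \<Rightarrow> constr \<Rightarrow> bool" where
  "violated ys (Key a) = False"
| "violated ys (Incl a b) = (ys ! a \<and> \<not> ys ! b)"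

lemma runs_check_constr:
  assumes "wf_constr (length ys) c"
  shows "runs check_constr (st u (True # enc_constr c @ v) (zt [] ys) n 0 0 b (of_bool q) z, w)
    (10 * length (enc_constr c) + 10)
    (st (u @ True # enc_constr c) v (zt [] ys) n 0 0 (b + Suc (length (enc_constr c)))
      (of_bool (q \<or> violated ys c)) z, w)"
proof (cases c)
  case (Key a)
  then have a: "a < length ys"
    using assms by simp
  note rules = runs_seek[OF a] runs_append[OF runs_seek[OF a]] runs_rewind_from[OF a]
  show ?thesis
    unfolding check_constr_def Key enc_constr.simps append.simps
    by (rule runs_eqI, (rule exec rules | unfold append_assoc append.simps append_Nil2)+) simp_all
next
  case (Incl a c)
  then have a: "a < length ys" and c: "c < length ys"
    using assms by simp_all
  note rules = exec runs_append[OF runs_seek[OF a]] runs_append[OF runs_seek[OF c]]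
    runs_rewind_from[OF c] runs_append[OF runs_rewind_from[OF a]]
  consider "\<not> ys ! a" | "ys ! a" "ys ! c" | "ys ! a" "\<not> ys ! c" q | "ys ! a" "\<not> ys ! c" "\<not> q"
    by blast
  then show ?thesis
  proof cases
    case 1
    show ?thesis
      unfolding check_constr_def Incl enc_constr.simps append.simps append_assoc
      by (rule runs_eqI, (rule rules exec_Cond_row(2)[OF 1] | unfold append_assoc append.simps append_Nil2)+)
        (use 1 in \<open>simp_all add: add.assoc\<close>)
  next
    case 2
    show ?thesis
      unfolding check_constr_def Incl enc_constr.simps append.simps append_assoc
      by (rule runs_eqI, (rule rules exec_Cond_row(1)[OF 2(1)] exec_Cond_row(1)[OF 2(2)] |
          unfold append_assoc append.simps append_Nil2)+) (use 2 in \<open>simp_all add: add.assoc\<close>)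
  next
    case 3
    then have q: "of_bool q = Suc 0"
      by simp
    show ?thesis
      unfolding check_constr_def Incl enc_constr.simps append.simps append_assoc q
      by (rule runs_eqI, (rule rules exec_Cond_row(1)[OF 3(1)] exec_Cond_row(2)[OF 3(2)] |
          unfold append_assoc append.simps append_Nil2)+) (use 3 in \<open>simp_all add: add.assoc\<close>)
  next
    case 4
    then have q: "of_bool q = (0::nat)"
      by simp
    show ?thesis
      unfolding check_constr_def Incl enc_constr.simps append.simps append_assoc q
      by (rule runs_eqI, (rule rules exec_Cond_row(1)[OF 4(1)] exec_Cond_row(2)[OF 4(2)] |
          unfold append_assoc append.simps append_Nil2)+) (use 4 in \<open>simp_all add: add.assoc\<close>)
  qed
qed

text \<open>This is \<open>enc_list enc_constr C\<close> without its closing bit, in front of which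
  the checking loop stops.\<close>

definition constrs_code :: "constr list \<Rightarrow> bool list" where
  "constrs_code C = concat (map (\<lambda>c. True # enc_constr c) C)"

definition check_part :: "instr list" where
  "check_part = [Until 0 1 check_constr]"

lemma runs_check_part:
  assumes "\<forall>c\<in>set C. wf_constr (length ys) c"
  shows "runs check_part (st u (constrs_code C @ False # v) (zt [] ys) n 0 0 b (of_bool q) z, w)
    (11 * length (constrs_code C) + 1)
    (st (u @ constrs_code C) (False # v) (zt [] ys) n 0 0 (b + length (constrs_code C))
      (of_bool (q \<or> (\<exists>c\<in>set C. violated ys c))) z, w)"
  using assms unfolding check_part_def
proof (induction C arbitrary: u b q)
  case Nil
  show ?case
    unfolding constrs_code_def list.map concat.simps append.simps
    by (rule runs_eqI, (rule exec)+) simp_all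
next
  case (Cons c C)
  have c: "constrs_code (c # C) = True # enc_constr c @ constrs_code C"
    by (simp add: constrs_code_def)
  note iter = exec_iter(1)[OF runs_check_constr Cons.IH]
  show ?case
    unfolding c append.simps append_assoc
    by (rule runs_eqI[OF iter]) (use Cons.prems in \<open>simp_all add: disj_assoc add.assoc\<close>)
qed

definition return_part :: "instr list" where
  "return_part = [Until 5 1 [Mv 5 Left, Mv 0 Left]]"

lemma runs_return_part:
  "runs return_part (st (u @ s) v y n a j (length s) f z, w) (3 * length s + 1) (st u (s @ v) y n a j 0 f z, w)"
  unfolding return_part_def
proof (induction s arbitrary: v rule: rev_induct)
  case Nil
  show ?case
    unfolding list.size by (rule runs_eqI, (rule exec)+) simp_all
next
  case (snoc c s)
  show ?case
    unfolding length_append list.size append_assoc[symmetric] add_0_right add_Suc_right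
    by (rule runs_eqI, (rule exec snoc)+) simp_all
qed

definition verdict_part :: "instr list" where
  "verdict_part = [Cond 6 1 [Put 7 False] [Put 7 True, Put 7 False, Mv 6 Left]]"

lemma runs_verdict_part:
  "runs verdict_part (st u v y n a j b (of_bool q) z, w) 4 (st u v y n a j b 0 (z @ enc_nat (of_bool q)), w)"
proof (cases q)
  case True
  then have q: "of_bool q = Suc 0"
    by simp
  show ?thesis
    unfolding q verdict_part_def
    by (rule runs_eqI, (rule exec | unfold append.simps)+) (simp_all add: enc_nat_simps)
next
  case False
  then have q: "of_bool q = (0::nat)"
    by simp
  show ?thesis
    unfolding q verdict_part_def
    by (rule runs_eqI, (rule exec | unfold append.simps)+) (simp_all add: enc_nat_simps)
qed

text \<open>A violated constraint only changes the target state, because every computation path must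
  complete the automaton.\<close>

definition transition :: "constr list \<Rightarrow> bool list \<Rightarrow> nat \<times> nat list \<times> nat" where
  "transition C ys = (0, filter (\<lambda>i. ys ! i) [0..<length ys], of_bool (\<exists>c\<in>set C. violated ys c))"

abbreviation enc_transition :: "nat \<times> nat list \<times> nat \<Rightarrow> bool list" where
  "enc_transition \<equiv> enc_pair enc_nat (enc_pair (enc_list enc_nat) enc_nat)"

text \<open>The bits emitted first are the list marker and the source state \<open>0\<close>. Rows
  have equal length, so the previous row is simply overwritten.\<close>

definition transition_part :: "instr list" where
  "transition_part = Mv 2 Left # Put 7 True # Put 7 False # row_part @ Put 7 False # clear @ rewind @
     check_part @ return_part @ verdict_part"

lemma runs_transition_part:
  fixes w :: guesses and ys :: "bool list"
  defines "row \<equiv> map w [0..<length ys]"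
  assumes "\<forall>c\<in>set C. wf_constr (length ys) c"
  shows "runs transition_part
    (st u (constrs_code C @ False # v) (zt [] ys) (Suc n) 0 0 0 0 z, w)
    (length ys * (7 * length ys + 12) + 14 * length (constrs_code C) + 20)
    (st u (constrs_code C @ False # v) (zt [] row) n 0 0 0 0
      (z @ True # enc_transition (transition C row)), \<lambda>i. w (i + length ys))"
proof -
  have row: "runs row_part (st u v (zt [] ys) n 0 0 b f z, w) (length ys * (7 * length ys + 8) + 1)
    (st u v (zt row []) n (length ys) 0 b f
      (z @ concat (map (\<lambda>i. True # enc_nat i) (filter (\<lambda>i. w i) [0..<length ys]))),
     \<lambda>i. w (i + length ys))" for u v n b f z
    using runs_row_part[of "[]" ys "length ys" u v n b f z w] by (simp add: row_def)
  have len: "length row = length ys"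
    by (simp add: row_def)
  have check: "runs check_part (st u (constrs_code C @ False # v) (zt [] row) n 0 0 0 0 z, w)
    (11 * length (constrs_code C) + 1)
    (st (u @ constrs_code C) (False # v) (zt [] row) n 0 0 (length (constrs_code C))
      (of_bool (\<exists>c\<in>set C. violated row c)) z, w)" for z w n
    using runs_check_part[of C row u v n 0 False z w] assms(2) by (simp add: len)
  \<comment> \<open>The emitted letter is selected by the guesses, the one in
    \<open>transition\<close> by the row to which they were written.\<close>
  have "filter (\<lambda>i. row ! i) [0..<length ys] = filter (\<lambda>i. w i) [0..<length ys]"
    by (rule filter_cong) (auto simp: row_def)
  then have code: "True # enc_transition (transition C row) = [True, False] @
      concat (map (\<lambda>i. True # enc_nat i) (filter (\<lambda>i. w i) [0..<length ys])) @ [False] @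
      enc_nat (of_bool (\<exists>c\<in>set C. violated row c))"
    by (simp add: transition_def enc_pair_def enc_list_concat len enc_nat_simps)
  show ?thesis
    unfolding transition_part_def code
    by (rule runs_eqI, (rule exec macros runs_append[OF row] runs_append[OF check]
        runs_append[OF runs_return_part] runs_verdict_part | unfold append_Nil2)+)
      (simp_all add: algebra_simps len)
qed

text \<open>After the first row the guesses left are \<open>w\<close> shifted by \<open>m\<close>,
  which turns row \<open>j\<close> of the shorter run into row \<open>j + 1\<close>.\<close>

lemma runs_transitions:
  assumes "\<forall>c\<in>set C. wf_constr (length ys) c" "length ys = m"
  shows "\<exists>ys' w'. runs [Until 2 1 transition_part]
    (st u (constrs_code C @ False # v) (zt [] ys) k 0 0 0 0 z, w)
    (k * (m * (7 * m + 12) + 14 * length (constrs_code C) + 21) + 1)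
    (st u (constrs_code C @ False # v) (zt [] ys') 0 0 0 0 0
      (z @ concat (map (\<lambda>j. True # enc_transition (transition C (map (\<lambda>i. w (j * m + i)) [0..<m]))) [0..<k])), w')"
  using assms
proof (induction k arbitrary: ys w z)
  case 0
  have "runs [Until 2 1 transition_part]
    (st u (constrs_code C @ False # v) (zt [] ys) 0 0 0 0 0 z, w) 1
    (st u (constrs_code C @ False # v) (zt [] ys) 0 0 0 0 0 z, w)"
    by (rule runs_eqI, (rule exec)+) simp_all
  then show ?case
    by auto
next
  case (Suc k)
  let ?row = "map w [0..<m]"
  obtain ys' w' where r: "runs [Until 2 1 transition_part]
    (st u (constrs_code C @ False # v) (zt [] ?row) k 0 0 0 0
      (z @ True # enc_transition (transition C ?row)), \<lambda>i. w (i + m))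
    (k * (m * (7 * m + 12) + 14 * length (constrs_code C) + 21) + 1)
    (st u (constrs_code C @ False # v) (zt [] ys') 0 0 0 0 0
      ((z @ True # enc_transition (transition C ?row)) @
       concat (map (\<lambda>j. True # enc_transition (transition C (map (\<lambda>i. w (j * m + i + m)) [0..<m]))) [0..<k])), w')"
    using Suc.IH[of ?row "z @ True # enc_transition (transition C ?row)" "\<lambda>i. w (i + m)"] Suc.prems by auto
  have shift: "map (\<lambda>j. True # enc_transition (transition C (map (\<lambda>i. w (j * m + i)) [0..<m]))) [0..<Suc k] =
      (True # enc_transition (transition C ?row)) #
      map (\<lambda>j. True # enc_transition (transition C (map (\<lambda>i. w (j * m + i + m)) [0..<m]))) [0..<k]"
    by (simp add: upt_conv_Cons map_Suc_upt[symmetric] algebra_simps del: upt_Suc)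
  have t: "runs transition_part (st u (constrs_code C @ False # v) (zt [] ys) (Suc k) 0 0 0 0 z, w)
    (m * (7 * m + 12) + 14 * length (constrs_code C) + 20)
    (st u (constrs_code C @ False # v) (zt [] ?row) k 0 0 0 0
      (z @ True # enc_transition (transition C ?row)), \<lambda>i. w (i + m))"
    using runs_transition_part[of C ys u v k z w] Suc.prems by simp
  show ?case
    unfolding shift
    by (intro exI, rule runs_eqI[OF exec_iter(3)[OF t r]]) (simp_all add: algebra_simps)
qed

section \<open>The weak ODTA written by the program\<close>

definition dtd_transducer :: "nat \<Rightarrow> dtd \<Rightarrow> transducer" where
  "dtd_transducer n D = \<lparr>tr_states = n, tr_final = [dtd_start D],
     tr_trans = map (\<lambda>a. (a, a, One)) (dtd_terminals D) @ map (\<lambda>(a, r). (a, a, r)) (dtd_prods D),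
     tr_out = map (\<lambda>a. (a, a, a)) [0..<n]\<rparr>"

text \<open>Row \<open>j\<close> of the matrix \<open>w\<close> is a guessed letter \<open>S\<close> of the automaton. It is read by a loop
  in the accepting state \<open>0\<close> if \<open>S\<close> respects the inclusion constraints; otherwise it leads to
  the dead state \<open>1\<close>.\<close>

definition class_nfa :: "nat \<Rightarrow> constr list \<Rightarrow> guesses \<Rightarrow> nfa" where
  "class_nfa n C w = \<lparr>nfa_size = 2, nfa_init = [0], nfa_final = [0],
     nfa_trans = map (\<lambda>j. transition C (map (\<lambda>i. w (j * n + i)) [0..<n])) [0..<n]\<rparr>"

primrec key_labels :: "constr \<Rightarrow> nat list" where
  "key_labels (Key a) = [a]"
| "key_labels (Incl a b) = []"

definition odta_of :: "nat \<Rightarrow> dtd \<Rightarrow> constr list \<Rightarrow> guesses \<Rightarrow> odta" where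
  "odta_of n D C w = \<lparr>od_in = n, od_out = n, od_trans = dtd_transducer n D,
     od_aut = class_nfa n C w, od_keys = concat (map key_labels C)\<rparr>"

definition init_part :: "instr list" where
  "init_part = [Put 2 False, Mv 2 Left, Put 3 False, Mv 3 Left, Put 4 False, Mv 4 Left,
     Put 5 False, Mv 5 Left, Put 6 False, Mv 6 Left]"

definition transducer_part :: "instr list" where
  "transducer_part = read_size @ rewind @ emit_count @ emit_count @ emit_clear @
     Put 7 True # read_nat @ emit_clear @ Put 7 False # terminals_part @ prods_part @
     Put 7 False # outs_part @ Put 7 False # clear @ rewind"

text \<open>The literal bits spell the size \<open>2\<close> of the string automaton, followed by
  the lists \<open>[0]\<close> of its initial and of its final states.\<close>

definition program :: "instr list" where
  "program = init_part @ transducer_part @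
     map (Put 7) [True, True, False, True, False, False, True, False, False] @
     Until 2 1 transition_part # Put 7 False # keys_part @ [Put 7 False]"

lemma runs_init_part: "runs init_part (start_tapes 8 x, w) 10 (st [] x (zt [] []) 0 0 0 0 0 [], w)"
proof -
  have blank: "((\<lambda>_. 0), 0) = zt [] []"
    by (auto simp: zt_def word_on_tape_def)
  have start: "start_tapes 8 x = [zt [] x, zt [] [], zt [] [], zt [] [], zt [] [], zt [] [], zt [] [], zt [] []]"
    unfolding start_tapes_def blank by (simp add: zt_def eval_nat_numeral)
  \<comment> \<open>With the premises in this order \<open>rule\<close> follows the execution and
    postpones the length conditions.\<close>
  have Mv: "runs q (T[k := mv d (T ! k)], w) b c \<Longrightarrow> k < length T \<Longrightarrow> runs (Mv k d # q) (T, w) (Suc b) c"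
    for q T k d b c
    by (rule runs_Mv)
  show ?thesis
    unfolding init_part_def start
    by (rule runs_eqI, (rule runs_Put Mv runs_Nil0)+)
      (simp_all add: st_def mv_Left_zt_ct eval_nat_numeral)
qed

lemma runs_transducer_part:
  fixes n D
  defines "T \<equiv> dtd_transducer n D"
  shows "runs transducer_part (st [] (enc_nat n @ enc_dtd D @ v) (zt [] []) 0 0 0 0 0 [], w)
    (n * (21 * n + 80) + 50 * length (enc_dtd D) + 100)
    (st (enc_nat n @ enc_dtd D) v (zt [] (replicate n False)) n 0 0 0 0
      (enc_nat n @ enc_nat n @ enc_transducer T), w)"
proof -
  have outs: "runs outs_part (st u v (zt [] (replicate n False)) n 0 0 0 0 z, w) (n * (21 * n + 14) + 1)
      (st u v (zt (replicate n False) []) n n 0 0 0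
        (z @ concat (map (\<lambda>i. True # enc_nat i @ enc_nat i @ enc_nat i) [0..<n])), w)" for u v z
    using runs_outs_part[of "[]" "replicate n False" n] by simp
  have rewind: "runs rewind (st u v (zt (replicate n False) []) m a j b f z, w) (2 * n + 3)
      (st u v (zt [] (replicate n False)) m a j b f z, w)" for u v m a j b f z
    using runs_rewind[of u v "replicate n False" "[]"] by simp
  have read_size: "runs read_size (st [] (enc_nat n @ v) (zt [] []) 0 0 0 0 0 [], w) (5 * n + 2)
      (st (enc_nat n) v (zt (replicate n False) []) n n 0 0 0 [], w)" for v
    using runs_read_size[of "[]" n v "[]" 0 0] by simp
  have trans: "concat (map (\<lambda>a. True # enc_nat a @ enc_nat a @ enc_rexp One) ts) @
      concat (map (\<lambda>(a, r). True # enc_nat a @ enc_nat a @ enc_rexp r) ps) @ [False] =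
      enc_list (enc_pair enc_nat (enc_pair enc_nat enc_rexp)) (map (\<lambda>a. (a, a, One)) ts @ map (\<lambda>(a, r). (a, a, r)) ps)"
    for ts ps
    by (simp add: enc_list_concat enc_pair_def o_def case_prod_unfold)
  have out: "concat (map (\<lambda>i. True # enc_nat i @ enc_nat i @ enc_nat i) [0..<n]) @ [False] =
      enc_list (enc_pair enc_nat (enc_pair enc_nat enc_nat)) (map (\<lambda>a. (a, a, a)) [0..<n])"
    by (simp add: enc_list_concat enc_pair_def o_def)
  have T: "enc_transducer T = enc_nat n @ (True # enc_nat (dtd_start D) @ [False]) @
      (concat (map (\<lambda>a. True # enc_nat a @ enc_nat a @ enc_rexp One) (dtd_terminals D)) @
      concat (map (\<lambda>(a, r). True # enc_nat a @ enc_nat a @ enc_rexp r) (dtd_prods D)) @ [False]) @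
      concat (map (\<lambda>i. True # enc_nat i @ enc_nat i @ enc_nat i) [0..<n]) @ [False]"
    unfolding trans out by (simp add: T_def dtd_transducer_def enc_transducer_def)
  show ?thesis
    unfolding transducer_part_def T enc_dtd_def append_assoc
    by (rule runs_eqI, (rule exec runs_append[OF read_size] runs_append[OF rewind] rewind
        runs_append[OF outs] runs_append[OF runs_terminals_part] runs_append[OF runs_prods_part]
        macros)+) (simp_all add: algebra_simps)
qed

text \<open>The cube reflects the size of the output: \<open>n\<close> rows of up to
  \<open>n\<close> labels, each written in unary.\<close>

lemma runs_program:
  assumes "\<forall>c\<in>set C. wf_constr n c"
  shows "\<exists>T w'. runs program (start_tapes 8 (enc_instance n D C), w)
    (200 * (length (enc_instance n D C) + 1) ^ 3) (T, w') \<and>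
    fst (last T) = word_on_tape (enc_odta (odta_of n D C w))"
proof -
  let ?x = "enc_instance n D C"
  have x: "?x = enc_nat n @ enc_dtd D @ constrs_code C @ [False]"
    by (simp add: enc_instance_def constrs_code_def enc_list_concat)
  let ?u = "enc_nat n @ enc_dtd D"
  let ?z = "(enc_nat n @ enc_nat n @ enc_transducer (dtd_transducer n D)) @
    [True, True, False, True, False, False, True, False, False]"
  let ?trans = "concat (map (\<lambda>j. True # enc_transition
    (transition C (map (\<lambda>i. w (j * n + i)) [0..<n]))) [0..<n])"
  obtain ys' w' where "runs [Until 2 1 transition_part]
    (st ?u (constrs_code C @ False # []) (zt [] (replicate n False)) n 0 0 0 0 ?z, w)
    (n * (n * (7 * n + 12) + 14 * length (constrs_code C) + 21) + 1)
    (st ?u (constrs_code C @ False # []) (zt [] ys') 0 0 0 0 0 (?z @ ?trans), w')"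
    using runs_transitions[of C "replicate n False" n ?u "[]" n ?z w] assms by auto
  moreover have "constrs_code C @ False # [] = enc_list enc_constr C"
    by (simp add: constrs_code_def enc_list_concat)
  ultimately have trans: "runs [Until 2 1 transition_part]
    (st ?u (enc_list enc_constr C @ []) (zt [] (replicate n False)) n 0 0 0 0 ?z, w)
    (n * (n * (7 * n + 12) + 14 * length (constrs_code C) + 21) + 1)
    (st ?u (enc_list enc_constr C @ []) (zt [] ys') 0 0 0 0 0 (?z @ ?trans), w')"
    by simp
  define out where "out = (?z @ ?trans @ [False]) @ concat (map key_code C) @ [False]"
  have keys: "concat (map key_code C) = concat (map (\<lambda>a. True # enc_nat a) (concat (map key_labels C)))"
  proof (induction C)
    case (Cons c C)
    then show ?case
      by (cases c) simp_all
  qed simp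
  have "enc_odta (odta_of n D C w) = out"
    unfolding out_def keys
    by (simp add: odta_of_def enc_odta_def class_nfa_def enc_nfa_def enc_list_concat o_def enc_nat_def
        numeral_2_eq_2)
  have put: "runs (map (Put 7) [True, True, False, True, False, False, True, False, False])
    (st u v y n 0 0 0 0 z, w) 9 (st u v y n 0 0 0 0 (z @ [True, True, False, True, False, False, True, False, False]), w)"
    for u v y n z w
    unfolding list.map by (rule runs_eqI, (rule exec)+) simp_all
  have "runs ([Until 2 1 transition_part] @ Put 7 False # keys_part @ [Put 7 False])
    (st ?u (enc_list enc_constr C @ []) (zt [] (replicate n False)) n 0 0 0 0 ?z, w)
    (n * (n * (7 * n + 12) + 14 * length (constrs_code C) + 21) + 21 * length (enc_list enc_constr C) + 10)
    (st (?u @ enc_list enc_constr C) [] (zt [] ys') 0 0 0 0 0 out, w')"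
    by (rule runs_eqI, (rule exec runs_append[OF trans] runs_append[OF runs_keys_part])+)
      (simp_all add: out_def)
  note rest = runs_append[OF put this[unfolded append.simps]]
  have "runs program (start_tapes 8 ?x, w)
    (10 + ((n * (21 * n + 80) + 50 * length (enc_dtd D) + 100) +
     (9 + (n * (n * (7 * n + 12) + 14 * length (constrs_code C) + 21) + 21 * length (enc_list enc_constr C) + 10))))
    (st (?u @ enc_list enc_constr C) [] (zt [] ys') 0 0 0 0 0 out, w')"
    unfolding program_def enc_instance_def
    using runs_append[OF runs_init_part runs_append[OF runs_transducer_part rest]] by simp
  moreover have "10 + ((n * (21 * n + 80) + 50 * length (enc_dtd D) + 100) +
     (9 + (n * (n * (7 * n + 12) + 14 * length (constrs_code C) + 21) + 21 * length (enc_list enc_constr C) + 10)))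
     \<le> 200 * (length ?x + 1) ^ 3" (is "?t \<le> _")
  proof -
    define K where "K = length ?x"
    have le: "n \<le> K" "length (enc_dtd D) \<le> K" "length (constrs_code C) \<le> K"
        "length (enc_list enc_constr C) \<le> K"
      by (simp_all add: K_def x) (simp add: constrs_code_def enc_list_concat)
    then have "?t \<le> 10 + ((K * (21 * K + 80) + 50 * K + 100) +
        (9 + (K * (K * (7 * K + 12) + 14 * K + 21) + 21 * K + 10)))"
      by (intro add_mono mult_mono order_refl) simp_all
    also have "\<dots> \<le> 200 * (K + 1) ^ 3"
      by (simp add: power3_eq_cube algebra_simps)
    finally show ?thesis
      by (simp add: K_def)
  qed
  moreover have "fst (last (st (?u @ enc_list enc_constr C) [] (zt [] ys') 0 0 0 0 0 out)) =
      word_on_tape (enc_odta (odta_of n D C w))"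
    using \<open>_ = out\<close> by (simp add: st_def zt_def)
  ultimately show ?thesis
    using runs_mono by blast
qed

text \<open>The blank differs from the codes of both bits, so the tape shows where the word
  ends.\<close>

lemma word_on_tape_inject: "word_on_tape x = word_on_tape y \<longleftrightarrow> x = y"
proof
  assume eq: "word_on_tape x = word_on_tape y"
  have len: "i < length z \<longleftrightarrow> word_on_tape z (int i) \<noteq> 0" for i z
    by (simp add: word_on_tape_def)
  have "i < length x \<longleftrightarrow> i < length y" for i
    by (simp add: len eq)
  then have "length x = length y"
    by (metis linorder_neqE_nat order_less_irrefl)
  moreover have "x ! i = y ! i" if "i < length x" for i
    using that eq[THEN fun_cong, of "int i"] \<open>length x = length y\<close>
    by (simp add: word_on_tape_def split: if_splits)
  ultimately show "x = y"
    by (rule nth_equalityI)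
qed simp

text \<open>The last clause determines the output of a path completely, since soundness is required
  of any automaton whose code appears on the tape.\<close>

theorem odta_of_computable:
  "\<exists>M p. wf_ntm M \<and> (\<forall>n D C. (\<forall>c\<in>set C. wf_constr n c) \<longrightarrow>
     time_bounded M (enc_instance n D C) (poly p (length (enc_instance n D C))) \<and>
     (\<forall>w. \<exists>cf. halts_with M (enc_instance n D C) cf \<and> config_output cf (enc_odta (odta_of n D C w))) \<and>
     (\<forall>cf. halts_with M (enc_instance n D C) cf \<longrightarrow>
        (\<exists>w. \<forall>y. config_output cf y \<longleftrightarrow> y = enc_odta (odta_of n D C w))))"
proof -
  obtain M where M: "wf_ntm M" "\<And>x B F. (\<forall>w. \<exists>t\<le>B. \<exists>w'. steps t (program, start_tapes 8 x, w) = Some ([], F w, w')) \<Longrightarrow>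
      time_bounded M x B \<and> (\<exists>q. {c. halts_with M x c} = {(q, F w) |w. True})"
    using machine_exists[of 8 program] by auto
  define p :: "nat poly" where "p = smult 200 ([:1, 1:] ^ 3)"
  have p: "poly p k = 200 * (k + 1) ^ 3" for k
    by (simp add: p_def)
  have "time_bounded M x (poly p (length x)) \<and>
      (\<forall>w. \<exists>cf. halts_with M x cf \<and> config_output cf (enc_odta (odta_of n D C w))) \<and>
      (\<forall>cf. halts_with M x cf \<longrightarrow> (\<exists>w. \<forall>y. config_output cf y \<longleftrightarrow> y = enc_odta (odta_of n D C w)))"
    if "\<forall>c\<in>set C. wf_constr n c" and x: "x = enc_instance n D C" for n D C x
  proof -
    have "\<forall>w. \<exists>T w'. runs program (start_tapes 8 x, w) (poly p (length x)) (T, w') \<and>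
        fst (last T) = word_on_tape (enc_odta (odta_of n D C w))"
      using runs_program[OF that(1)] by (simp add: p x)
    then obtain F where F: "\<And>w. \<exists>w'. runs program (start_tapes 8 x, w) (poly p (length x)) (F w, w')"
        "\<And>w. fst (last (F w)) = word_on_tape (enc_odta (odta_of n D C w))"
      by metis
    have "\<forall>w. \<exists>t\<le>poly p (length x). \<exists>w'. steps t (program, start_tapes 8 x, w) = Some ([], F w, w')"
      using F(1) unfolding runs_def by (metis append_Nil2)
    from M(2)[OF this] obtain q where q: "time_bounded M x (poly p (length x))"
        "{c. halts_with M x c} = {(q, F w) |w. True}"
      by blast
    then have "halts_with M x c \<longleftrightarrow> (\<exists>w. c = (q, F w))" for c
      by blast
    then show ?thesis
      using q(1) by (auto simp: config_output_def F(2) word_on_tape_inject)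
  qed
  then show ?thesis
    using M(1) by blast
qed

section \<open>Nodes of trees\<close>

lemma subtree_append: "subtree t (u @ v) = subtree (subtree t u) v"
  by (induction u arbitrary: t) simp_all

lemma nodes_map_tree_aux:
  "u \<in> nodes t \<Longrightarrow> u \<in> nodes (map_tree f t) \<and> subtree (map_tree f t) u = map_tree f (subtree t u)"
proof (induction rule: nodes.induct)
  case 1
  show ?case
    by (simp add: nodes.intros)
next
  case (2 u i)
  then have "children (subtree (map_tree f t) u) = map (map_tree f) (children (subtree t u))"
    by (cases "subtree t u") simp
  then show ?case
    using 2 by (auto simp: subtree_append intro: nodes.intros)
qed

lemma nodes_map_tree_rev: "u \<in> nodes (map_tree f t) \<Longrightarrow> u \<in> nodes t"
proof (induction rule: nodes.induct)
  case 1
  show ?case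
    by (rule nodes.intros)
next
  case (2 u i)
  then have "children (subtree (map_tree f t) u) = map (map_tree f) (children (subtree t u))"
    using nodes_map_tree_aux[of u t f] by (cases "subtree t u") simp
  then show ?case
    using 2 by (auto intro: nodes.intros)
qed

lemma nodes_map_tree [simp]: "nodes (map_tree f t) = nodes t"
  using nodes_map_tree_aux nodes_map_tree_rev by blast

lemma val_at_map_tree [simp]: "u \<in> nodes t \<Longrightarrow> val_at (map_tree f t) u = f (val_at t u)"
  using nodes_map_tree_aux[of u t f] by (cases "subtree t u") (simp add: val_at_def)

lemma nodes_Proj [simp]: "nodes (Proj t) = nodes t"
  by (simp add: Proj_def)

lemma val_at_Proj [simp]: "u \<in> nodes t \<Longrightarrow> val_at (Proj t) u = lab t u"
  by (simp add: Proj_def lab_def)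

text \<open>\<open>nodes\<close> extends addresses at the end; finiteness by induction on the tree
  needs a recursion that consumes them from the front.\<close>

primrec address :: "'a tree \<Rightarrow> nat list \<Rightarrow> bool" where
  "address t [] = True"
| "address t (i # u) = (i < length (children t) \<and> address (children t ! i) u)"

lemma address_snoc: "address t u \<Longrightarrow> i < length (children (subtree t u)) \<Longrightarrow> address t (u @ [i])"
  by (induction u arbitrary: t) simp_all

lemma finite_addresses: "finite {u. address t u}"
proof (induction t)
  case (Node a ts)
  have "{u. address (Node a ts) u} = insert [] (\<Union>i<length ts. Cons i ` {u. address (ts ! i) u})"
  proof (intro set_eqI)
    fix u
    show "u \<in> {u. address (Node a ts) u} \<longleftrightarrow>
        u \<in> insert [] (\<Union>i<length ts. Cons i ` {u. address (ts ! i) u})"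
      by (cases u) auto
  qed
  then show ?case
    using Node by simp
qed

lemma finite_nodes: "finite (nodes t)"
proof -
  have "address t u" if "u \<in> nodes t" for u
    using that by induction (auto intro: address_snoc)
  then show ?thesis
    using finite_addresses[of t] by (meson finite_subset mem_Collect_eq subsetI)
qed

text \<open>A value \<open>d\<close> lies in exactly one class, that of the labels carrying it. The
  set of letters is enough to know, because an automaton whose accepting runs stay in one state
  ignores order and repetition.\<close>

lemma set_vword: "set (vword g t) = (\<lambda>u. {a. a < g \<and> dat t u \<in> V t a}) ` nodes t"
proof -
  have "(THE S. S \<subseteq> {..<g} \<and> d \<in> cls g t S) = {a. a < g \<and> d \<in> V t a}" for d
    by (rule the_equality) (auto simp: cls_def)
  then show ?thesis
    by (auto simp: vword_def finite_nodes)
qed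

section \<open>The constructed automaton\<close>

text \<open>\<open>tr_out\<close> makes state, input label and output label coincide, so the
  labelling is the only possible run. Terminals have no productions in a well-formed DTD, hence
  \<open>tr_delta\<close> allows them no children.\<close>

lemma output_on_dtd_transducer:
  assumes "wf_dtd n D"
  shows "output_on (dtd_transducer n D) s s' \<longleftrightarrow>
    nodes s' = nodes s \<and> (\<forall>u\<in>nodes s. val_at s' u = val_at s u) \<and> derivation_tree n D s"
proof -
  let ?T = "dtd_transducer n D"
  have delta: "tr_delta ?T a a = (if a \<in> set (dtd_terminals D) then {[]}
      else {v. \<exists>r. (a, r) \<in> set (dtd_prods D) \<and> v \<in> lang r})" for a
  proof -
    have "(a, a, r) \<in> set (tr_trans ?T) \<longleftrightarrow> r = One \<and> a \<in> set (dtd_terminals D) \<or> (a, r) \<in> set (dtd_prods D)"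
      for r
      by (auto simp: dtd_transducer_def)
    moreover have "(a, r) \<notin> set (dtd_prods D)" if "a \<in> set (dtd_terminals D)" for r
      using assms that unfolding wf_dtd_def by blast
    ultimately show ?thesis
      by (auto simp: tr_delta_def)
  qed
  have run: "accepting_run ?T s \<rho> \<longleftrightarrow> derivation_tree n D s"
    if \<rho>: "\<And>u. u \<in> nodes s \<Longrightarrow> \<rho> u = val_at s u" for \<rho>
  proof -
    have children: "map (\<lambda>i. \<rho> (u @ [i])) [0..<arity s u] = map (\<lambda>i. val_at s (u @ [i])) [0..<arity s u]"
      if "u \<in> nodes s" for u
      using that by (auto simp: arity_def intro!: \<rho> nodes.intros)
    have "accepting_run ?T s \<rho> \<longleftrightarrow> val_at s [] = dtd_start D \<and> (\<forall>u\<in>nodes s. val_at s u < n \<and>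
        map (\<lambda>i. val_at s (u @ [i])) [0..<arity s u] \<in> tr_delta ?T (val_at s u) (val_at s u))"
      unfolding accepting_run_def
      by (simp add: \<rho> nodes.intros(1) children dtd_transducer_def del: map_eq_conv cong: ball_cong)
    then show ?thesis
      by (auto simp: derivation_tree_def delta)
  qed
  have out: "(q, a, b) \<in> set (tr_out ?T) \<longleftrightarrow> q = a \<and> b = a \<and> a < n" for q a b
    by (auto simp: dtd_transducer_def)
  show ?thesis
  proof
    assume "output_on ?T s s'"
    then show "nodes s' = nodes s \<and> (\<forall>u\<in>nodes s. val_at s' u = val_at s u) \<and> derivation_tree n D s"
      using run unfolding output_on_def out by blast
  next
    assume "nodes s' = nodes s \<and> (\<forall>u\<in>nodes s. val_at s' u = val_at s u) \<and> derivation_tree n D s"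
    then show "output_on ?T s s'"
      using run[of "val_at s"] unfolding output_on_def out derivation_tree_def by blast
  qed
qed

text \<open>All transitions start in \<open>0\<close> and acceptance requires ending there, so every
  letter read must belong to a loop.\<close>

lemma class_nfa_accepts:
  assumes wf: "\<forall>c\<in>set C. wf_constr n c"
  shows "nfa_accepts (class_nfa n C w) xs \<longleftrightarrow> (\<forall>S\<in>set xs. \<exists>j<n. S = {i. i < n \<and> w (j * n + i)} \<and>
    (\<forall>a b. Incl a b \<in> set C \<longrightarrow> a \<in> S \<longrightarrow> b \<in> S))"
proof -
  define bad where "bad j \<longleftrightarrow> (\<exists>a b. Incl a b \<in> set C \<and> w (j * n + a) \<and> \<not> w (j * n + b))" for j
  have violated: "violated (map (\<lambda>i. w (j * n + i)) [0..<n]) c \<longleftrightarrow>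
      (\<exists>a b. c = Incl a b \<and> w (j * n + a) \<and> \<not> w (j * n + b))" if "c \<in> set C" for c j
    using wf that by (cases c) force+
  have row: "transition C (map (\<lambda>i. w (j * n + i)) [0..<n]) =
      (0, filter (\<lambda>i. w (j * n + i)) [0..<n], of_bool (bad j))" for j
  proof -
    have "filter (\<lambda>i. map (\<lambda>i. w (j * n + i)) [0..<n] ! i) [0..<n] = filter (\<lambda>i. w (j * n + i)) [0..<n]"
      by (rule filter_cong) auto
    moreover have "(\<exists>c\<in>set C. violated (map (\<lambda>i. w (j * n + i)) [0..<n]) c) \<longleftrightarrow> bad j"
      unfolding bad_def using violated by blast
    ultimately show ?thesis
      by (simp add: transition_def)
  qed
  have trans: "(p, S, q) \<in> set (nfa_trans (class_nfa n C w)) \<longleftrightarrow> (\<exists>j<n. p = 0 \<and>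
      S = filter (\<lambda>i. w (j * n + i)) [0..<n] \<and> q = of_bool (bad j))" for p S q
    by (auto simp: class_nfa_def row)
  \<comment> \<open>The constraints mention only labels below \<open>n\<close>, so row bits and
    membership in the letter agree on them.\<close>
  have closed: "bad j \<longleftrightarrow> \<not> (\<forall>a b. Incl a b \<in> set C \<longrightarrow>
      a \<in> {i. i < n \<and> w (j * n + i)} \<longrightarrow> b \<in> {i. i < n \<and> w (j * n + i)})" for j
    using wf unfolding bad_def by fastforce
  show ?thesis
  proof
    assume "nfa_accepts (class_nfa n C w) xs"
    then obtain r where r: "length r = Suc (length xs)" "r ! length xs = 0"
        "\<And>i. i < length xs \<Longrightarrow> \<exists>S. set S = xs ! i \<and> (r ! i, S, r ! Suc i) \<in> set (nfa_trans (class_nfa n C w))"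
      by (auto simp: nfa_accepts_def class_nfa_def)
    have zero: "r ! i = 0" if "i \<le> length xs" for i
      using that r(2) r(3)[of i] unfolding trans by (cases "i = length xs") auto
    show "\<forall>S\<in>set xs. \<exists>j<n. S = {i. i < n \<and> w (j * n + i)} \<and>
        (\<forall>a b. Incl a b \<in> set C \<longrightarrow> a \<in> S \<longrightarrow> b \<in> S)"
    proof
      fix S
      assume "S \<in> set xs"
      then obtain i where i: "i < length xs" "S = xs ! i"
        by (auto simp: in_set_conv_nth)
      obtain T where T: "set T = xs ! i" "(r ! i, T, r ! Suc i) \<in> set (nfa_trans (class_nfa n C w))"
        using r(3)[OF i(1)] by blast
      then obtain j where j: "j < n" "T = filter (\<lambda>i. w (j * n + i)) [0..<n]" "r ! Suc i = of_bool (bad j)"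
        unfolding trans by blast
      have "\<not> bad j"
        using j(3) zero[of "Suc i"] i(1) by simp
      moreover have "S = {i. i < n \<and> w (j * n + i)}"
        using T(1) i(2) j(2) by auto
      ultimately show "\<exists>j<n. S = {i. i < n \<and> w (j * n + i)} \<and> (\<forall>a b. Incl a b \<in> set C \<longrightarrow> a \<in> S \<longrightarrow> b \<in> S)"
        using j(1) closed[of j] by blast
    qed
  next
    assume asm: "\<forall>S\<in>set xs. \<exists>j<n. S = {i. i < n \<and> w (j * n + i)} \<and>
        (\<forall>a b. Incl a b \<in> set C \<longrightarrow> a \<in> S \<longrightarrow> b \<in> S)"
    have "\<exists>S. set S = xs ! i \<and> (0, S, 0) \<in> set (nfa_trans (class_nfa n C w))" if i: "i < length xs" for i
    proof -
      obtain j where j: "j < n" "xs ! i = {i. i < n \<and> w (j * n + i)}"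
          "\<forall>a b. Incl a b \<in> set C \<longrightarrow> a \<in> xs ! i \<longrightarrow> b \<in> xs ! i"
        using bspec[OF asm nth_mem[OF i]] by (elim exE conjE) blast
      have "\<not> bad j"
        using j(3) unfolding closed j(2) by simp
      then show ?thesis
        unfolding trans using j(1,2) by (intro exI[of _ "filter (\<lambda>i. w (j * n + i)) [0..<n]"]) auto
    qed
    then show "nfa_accepts (class_nfa n C w) xs"
      unfolding nfa_accepts_def
      by (intro exI[of _ "replicate (Suc (length xs)) 0"]) (auto simp: class_nfa_def nth_Cons' simp del: replicate_Suc)
  qed
qed

lemma wf_odta_of:
  assumes "wf_dtd n D" "\<forall>c\<in>set C. wf_constr n c"
  shows "wf_odta (odta_of n D C w)"
proof -
  have "set (key_labels c) \<subseteq> {..<n}" if "c \<in> set C" for c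
    using assms(2) that by (cases c) auto
  moreover have "wf_transducer n n (dtd_transducer n D)"
    using assms(1) by (fastforce simp: wf_transducer_def dtd_transducer_def wf_dtd_def)
  moreover have "wf_nfa n (class_nfa n C w)"
    by (auto simp: wf_nfa_def class_nfa_def transition_def)
  ultimately show ?thesis
    by (fastforce simp: wf_odta_def odta_of_def)
qed

lemma set_key_labels: "a \<in> set (concat (map key_labels C)) \<longleftrightarrow> Key a \<in> set C"
proof -
  have "a \<in> set (key_labels c) \<longleftrightarrow> c = Key a" for c
    by (cases c) auto
  then show ?thesis
    by auto
qed

text \<open>Holds for every guess \<open>w\<close>: the output tree repeats the labels and data of
  \<open>t\<close>, and the letter read at the value of an \<open>a\<close>-node contains
  \<open>a\<close>, hence also \<open>b\<close>.\<close>

lemma odta_of_sound: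
  assumes wf: "wf_dtd n D" "\<forall>c\<in>set C. wf_constr n c" and acc: "odta_accepts (odta_of n D C w) t"
  shows "tree_over n t \<and> conforms n D t \<and> (\<forall>c\<in>set C. sat t c)"
proof -
  obtain t' where t': "tree_over n t" "output_on (dtd_transducer n D) (Proj t) (Proj t')"
      "\<forall>u\<in>nodes t. dat t' u = dat t u" "nfa_accepts (class_nfa n C w) (vword n t')"
      "\<forall>a. Key a \<in> set C \<longrightarrow> (\<forall>x\<in>nodes t'. \<forall>y\<in>nodes t'.
         lab t' x = a \<and> lab t' y = a \<and> x \<noteq> y \<longrightarrow> dat t' x \<noteq> dat t' y)"
    using acc by (auto simp: odta_accepts_def odta_of_def set_key_labels simp del: set_concat)
  have nodes: "nodes t' = nodes t" and lab: "\<And>u. u \<in> nodes t \<Longrightarrow> lab t' u = lab t u"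
      and conf: "conforms n D t"
    using t'(2) unfolding output_on_dtd_transducer[OF wf(1)] conforms_def by auto
  have "sat t c" if c: "c \<in> set C" for c
  proof (cases c)
    case (Key a)
    then show ?thesis
      using t'(3,5) c nodes lab by auto
  next
    case (Incl a b)
    have "\<exists>y\<in>nodes t. lab t y = b \<and> dat t x = dat t y" if x: "x \<in> nodes t" "lab t x = a" for x
    proof -
      let ?S = "{a. a < n \<and> dat t' x \<in> V t' a}"
      have "?S \<in> set (vword n t')"
        using x(1) by (auto simp: set_vword nodes)
      from bspec[OF iffD1[OF class_nfa_accepts[OF wf(2)] t'(4)] this]
      have "\<forall>a b. Incl a b \<in> set C \<longrightarrow> a \<in> ?S \<longrightarrow> b \<in> ?S"
        by (elim exE conjE)
      then have "a \<in> ?S \<longrightarrow> b \<in> ?S"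
        using c unfolding Incl by blast
      moreover have "a < n" "dat t' x \<in> V t' a"
        using wf(2) c Incl x lab by (auto simp: V_def nodes)
      ultimately show ?thesis
        using t'(3) x(1) lab by (auto simp: V_def nodes)
    qed
    then show ?thesis
      using Incl by auto
  qed
  then show ?thesis
    using t'(1) conf by blast
qed

section \<open>Compressing the data values\<close>

text \<open>Counting smaller elements is strictly increasing on \<open>A\<close> and stays below
  \<open>card A\<close>; injectivity and equal cardinality make it onto.\<close>

lemma rank_bij:
  fixes A :: "nat set"
  assumes "finite A"
  shows "bij_betw (\<lambda>d. card {e \<in> A. e < d}) A {..<card A}"
proof -
  let ?f = "\<lambda>d. card {e \<in> A. e < d}"
  have less: "?f d < ?f d'" if "d \<in> A" "d < d'" for d d'
    using that assms by (intro psubset_card_mono) auto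
  have inj: "inj_on ?f A"
  proof (rule inj_onI)
    fix d d'
    assume "d \<in> A" "d' \<in> A" "?f d = ?f d'"
    then show "d = d'"
      using less[of d d'] less[of d' d] by (cases d d' rule: linorder_cases) simp_all
  qed
  have "?f d < card A" if "d \<in> A" for d
    using that assms by (intro psubset_card_mono) auto
  then have "?f ` A \<subseteq> {..<card A}"
    by auto
  then have "?f ` A = {..<card A}"
    by (rule card_subset_eq[rotated]) (simp_all add: card_image[OF inj])
  then show ?thesis
    using inj by (simp add: bij_betw_def)
qed

lemma finite_V: "finite (V t a)"
proof -
  have "V t a \<subseteq> dat t ` nodes t"
    by (auto simp: V_def)
  then show ?thesis
    using finite_nodes by (meson finite_imageI finite_subset)
qed

text \<open>The rank is taken among the values of the node's own label. Equal values under different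
  labels may separate, but no constraint tracks which nodes of two labels share a value.\<close>

definition compress :: "dtree \<Rightarrow> dtree" where
  "compress t = map_tree (\<lambda>(a, d). (a, card {e \<in> V t a. e < d})) t"

lemma nodes_compress [simp]: "nodes (compress t) = nodes t"
  by (simp add: compress_def)

lemma lab_compress [simp]: "u \<in> nodes t \<Longrightarrow> lab (compress t) u = lab t u"
  by (simp add: compress_def lab_def case_prod_unfold)

lemma dat_compress: "u \<in> nodes t \<Longrightarrow> dat (compress t) u = card {e \<in> V t (lab t u). e < dat t u}"
  by (simp add: compress_def dat_def lab_def case_prod_unfold)

lemma Proj_compress: "Proj (compress t) = Proj t"
  by (simp add: Proj_def compress_def tree.map_comp o_def case_prod_unfold)

lemma V_compress: "V (compress t) a = {..<card (V t a)}"
proof -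
  have "V (compress t) a = (\<lambda>d. card {e \<in> V t a. e < d}) ` V t a"
    by (force simp: V_def dat_compress)
  then show ?thesis
    using rank_bij[OF finite_V] by (simp add: bij_betw_def)
qed

text \<open>After compression the sets of data values of the labels form a chain, so the classes of
  the data values are among the sets \<open>{i. card (V t j) \<le> card (V t i)}\<close>, one for each label \<open>j\<close>.\<close>

lemma odta_of_complete:
  assumes wf: "wf_dtd n D" "\<forall>c\<in>set C. wf_constr n c"
    and t: "tree_over n t" "conforms n D t" "\<forall>c\<in>set C. sat t c"
  shows "odta_accepts (odta_of n D C (\<lambda>k. card (V t (k div n)) \<le> card (V t (k mod n)))) (compress t)"
    (is "odta_accepts (odta_of n D C ?w) ?t")
proof -
  define v where "v a = card (V t a)" for a
  have V: "V ?t a = {..<v a}" for a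
    by (simp add: V_compress v_def)
  \<comment> \<open>\<open>k div n\<close> and \<open>k mod n\<close> recover row and column from
    the position \<open>k = j * n + i\<close> in the matrix of guesses.\<close>
  have w: "?w (j * n + i) \<longleftrightarrow> v j \<le> v i" if "i < n" for i j
    using that by (simp add: v_def)
  have over: "tree_over n ?t"
    using t(1) by (simp add: tree_over_def)
  have incl: "v a \<le> v b" if "Incl a b \<in> set C" for a b
  proof -
    have "V t a \<subseteq> V t b"
      using that t(3) unfolding V_def by fastforce
    then show ?thesis
      unfolding v_def by (rule card_mono[OF finite_V])
  qed
  have "\<exists>j<n. S = {i. i < n \<and> ?w (j * n + i)} \<and> (\<forall>a b. Incl a b \<in> set C \<longrightarrow> a \<in> S \<longrightarrow> b \<in> S)"
    if S: "S \<in> set (vword n ?t)" for S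
  proof -
    obtain u where u: "u \<in> nodes t" "S = {a. a < n \<and> dat ?t u < v a}"
      using S unfolding set_vword V nodes_compress lessThan_iff by blast
    have "dat ?t u \<in> V ?t (lab t u)"
      using u(1) lab_compress[OF u(1)] unfolding V_def by force
    then have "lab t u \<in> S"
      using t(1) u by (auto simp: V tree_over_def)
    \<comment> \<open>\<open>S\<close> is upward closed with respect to \<open>v\<close>, so a label
      \<open>j\<close> in \<open>S\<close> with fewest values generates it; the label of
      \<open>u\<close> shows that \<open>S\<close> is nonempty.\<close>
    then obtain j where j: "j \<in> S" "\<And>a. a \<in> S \<Longrightarrow> v j \<le> v a"
      using ex_has_least_nat[of "\<lambda>a. a \<in> S" "lab t u" v] by blast
    have "S = {i. i < n \<and> v j \<le> v i}"
      using j u(2) by fastforce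
    moreover have "b \<in> S" if "Incl a b \<in> set C" "a \<in> S" for a b
      using that incl[OF that(1)] wf(2) u(2) by fastforce
    ultimately show ?thesis
      using j(1) u(2) w by (intro exI[of _ j]) auto
  qed
  then have acc: "nfa_accepts (class_nfa n C ?w) (vword n ?t)"
    unfolding class_nfa_accepts[OF wf(2)] by blast
  have key: "dat ?t x \<noteq> dat ?t y"
    if "Key a \<in> set C" "x \<in> nodes t" "y \<in> nodes t" "lab t x = a" "lab t y = a" "x \<noteq> y" for a x y
  proof -
    have "dat t x \<noteq> dat t y"
      using that t(3) by fastforce
    \<comment> \<open>Both values are ranked in the same set, where ranking is injective.\<close>
    moreover have "dat t x \<in> V t a" "dat t y \<in> V t a"
      using that by (auto simp: V_def)
    ultimately show ?thesis
      using rank_bij[OF finite_V, of t a] that by (auto simp: dat_compress bij_betw_def dest: inj_onD)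
  qed
  have "output_on (dtd_transducer n D) (Proj ?t) (Proj ?t)"
    using t(2) unfolding output_on_dtd_transducer[OF wf(1)] by (simp add: conforms_def Proj_compress)
  then show ?thesis
    using over acc key unfolding odta_accepts_def
    by (intro conjI exI[of _ ?t]) (auto simp: odta_of_def set_key_labels simp del: set_concat)
qed

theorem theorem6p4:
  shows "\<exists>(M :: ntm) (p :: nat poly). wf_ntm M \<and>
    (\<forall>(n :: nat) (D :: dtd) (C :: constr list).
       wf_dtd n D \<and> (\<forall>c\<in>set C. wf_constr n c) \<longrightarrow>
       time_bounded M (enc_instance n D C) (poly p (length (enc_instance n D C))) \<and>
       (\<forall>cf. halts_with M (enc_instance n D C) cf \<longrightarrow>
          (\<exists>S. wf_odta S \<and> od_in S = n \<and> config_output cf (enc_odta S))) \<and>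
       ((\<exists>cf S. halts_with M (enc_instance n D C) cf \<and> config_output cf (enc_odta S) \<and>
           (\<exists>t. odta_accepts S t)) \<longleftrightarrow>
        (\<exists>t. tree_over n t \<and> conforms n D t \<and> (\<forall>c\<in>set C. sat t c))))"
proof -
  obtain M p where M: "wf_ntm M" and
    computes: "\<forall>n D C. (\<forall>c\<in>set C. wf_constr n c) \<longrightarrow>
     time_bounded M (enc_instance n D C) (poly p (length (enc_instance n D C))) \<and>
     (\<forall>w. \<exists>cf. halts_with M (enc_instance n D C) cf \<and> config_output cf (enc_odta (odta_of n D C w))) \<and>
     (\<forall>cf. halts_with M (enc_instance n D C) cf \<longrightarrow>
        (\<exists>w. \<forall>y. config_output cf y \<longleftrightarrow> y = enc_odta (odta_of n D C w)))"
    using odta_of_computable by (elim exE conjE) (rule that)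
  have "time_bounded M (enc_instance n D C) (poly p (length (enc_instance n D C))) \<and>
       (\<forall>cf. halts_with M (enc_instance n D C) cf \<longrightarrow>
          (\<exists>S. wf_odta S \<and> od_in S = n \<and> config_output cf (enc_odta S))) \<and>
       ((\<exists>cf S. halts_with M (enc_instance n D C) cf \<and> config_output cf (enc_odta S) \<and>
           (\<exists>t. odta_accepts S t)) \<longleftrightarrow>
        (\<exists>t. tree_over n t \<and> conforms n D t \<and> (\<forall>c\<in>set C. sat t c)))"
    if wf: "wf_dtd n D" "\<forall>c\<in>set C. wf_constr n c" for n D C
  proof -
    have run: "time_bounded M (enc_instance n D C) (poly p (length (enc_instance n D C)))"
      "\<exists>cf. halts_with M (enc_instance n D C) cf \<and> config_output cf (enc_odta (odta_of n D C w))"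
      "halts_with M (enc_instance n D C) cf \<Longrightarrow> \<exists>w. \<forall>y. config_output cf y \<longleftrightarrow> y = enc_odta (odta_of n D C w)"
      for w cf
      using computes[THEN spec, THEN spec, THEN spec, THEN mp, OF wf(2)] by blast+
    show ?thesis
    proof (intro conjI allI impI)
      show "time_bounded M (enc_instance n D C) (poly p (length (enc_instance n D C)))"
        using run by blast
    next
      fix cf
      assume "halts_with M (enc_instance n D C) cf"
      then obtain w where "config_output cf (enc_odta (odta_of n D C w))"
        using run by blast
      moreover have "od_in (odta_of n D C w) = n"
        by (simp add: odta_of_def)
      ultimately show "\<exists>S. wf_odta S \<and> od_in S = n \<and> config_output cf (enc_odta S)"
        using wf_odta_of[OF wf] by blast
    next
      show "(\<exists>cf S. halts_with M (enc_instance n D C) cf \<and> config_output cf (enc_odta S) \<and>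
             (\<exists>t. odta_accepts S t)) \<longleftrightarrow>
          (\<exists>t. tree_over n t \<and> conforms n D t \<and> (\<forall>c\<in>set C. sat t c))"
      proof
        assume "\<exists>cf S. halts_with M (enc_instance n D C) cf \<and> config_output cf (enc_odta S) \<and>
             (\<exists>t. odta_accepts S t)"
        then obtain cf S t where S: "halts_with M (enc_instance n D C) cf" "config_output cf (enc_odta S)"
            "odta_accepts S t"
          by blast
        obtain w where "enc_odta S = enc_odta (odta_of n D C w)"
          using run S(1,2) by blast
        then have "odta_accepts (odta_of n D C w) t"
          using S(3) by (simp add: enc_odta_inject)
        then show "\<exists>t. tree_over n t \<and> conforms n D t \<and> (\<forall>c\<in>set C. sat t c)"
          using odta_of_sound[OF wf] by blast
      next
        assume "\<exists>t. tree_over n t \<and> conforms n D t \<and> (\<forall>c\<in>set C. sat t c)"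
        \<comment> \<open>The accepted tree is \<open>compress t\<close>, and the path is the one
          whose guesses form the matrix of \<open>odta_of_complete\<close>.\<close>
        then show "\<exists>cf S. halts_with M (enc_instance n D C) cf \<and> config_output cf (enc_odta S) \<and>
             (\<exists>t. odta_accepts S t)"
          using odta_of_complete[OF wf] run by blast
      qed
    qed
  qed
  then show ?thesis
    using M by blast
qed

end
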